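(* Let $f=e^{g}$ be a probability density on $\mathbb{R}$ with $g$ eight times continuously differentiable, satisfying $|g(x)|,|g^{(i)}(x)|\le C(1+|x|^{K_0})$ for $1\le i\le 8$ and some constants $C,K_0>0$, with $\int_{\mathbb{R}}|x|^k f(x)\,dx<\infty$ for all $k\ge1$, and with $g'$ Lipschitz. Suppose $c_d\to c$ as $d\to\infty$ for some $0<c\le1$, and fix $l>0$. Then for the MALA-within-Gibbs algorithm with $\sigma_d^2=l^2d^{-1/3}$, $$\lim_{d\to\infty}a^{c_d}_d(l)=a^c(l)=2\Phi\!\left(-\frac{\sqrt{c}\,\kappa\, l^3}{2}\right),$$ where $\kappa>0$ is given by $\kappa^2=\mathbb{E}_f\!\left[\frac{5g'''(X)^2-3g''(X)^3}{48}\right]>0$.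
   Context: Target: $\pi_d(\mathbf{x})=\prod_{i=1}^d f(x_i)$. For each $d$, $c_d\in(0,1]$ with $dc_d$ an integer. MALA-within-Gibbs with step $\sigma_d$: from $\mathbf{x}$, choose a uniformly random subset $A$ of $\{1,\dots,d\}$ of size $dc_d$, $\chi_i=\mathbf 1\{i\in A\}$, draw $Z_i$ i.i.d. $N(0,1)$ independent of $A$, propose $Y_i=x_i+\chi_i\{\sigma_dZ_i+\frac{\sigma_d^2}{2}g'(x_i)\}$, and accept with probability $1\wedge\frac{\pi_d(\mathbf{Y})q(\mathbf{Y},\mathbf{x})}{\pi_d(\mathbf{x})q(\mathbf{x},\mathbf{Y})}$, where $q$ is the proposal density (for the updated coordinates), else stay. The average acceptance rate is $a^{c_d}_d(l)=\mathbb{E}\left[1\wedge\frac{\pi_d(\mathbf{Y})q(\mathbf{Y},\mathbf{X})}{\pi_d(\mathbf{X})q(\mathbf{X},\mathbf{Y})}\right]$ with $\mathbf{X}\sim\pi_d$. $\Phi$ is the standard normal c.d.f. *)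

theory Defs
  imports "HOL-Probability.Probability"
begin

definition Phi :: "real \<Rightarrow> real" where
  "Phi x = measure (density lborel std_normal_density) {..x}"

definition mala_q1 :: "(real \<Rightarrow> real) \<Rightarrow> real \<Rightarrow> real \<Rightarrow> real \<Rightarrow> real" where
  "mala_q1 g \<sigma> x y = normal_density (x + \<sigma>\<^sup>2 / 2 * deriv g x) \<sigma> y"

definition mala_prop ::
  "(real \<Rightarrow> real) \<Rightarrow> real \<Rightarrow> nat set \<Rightarrow> (nat \<Rightarrow> real) \<Rightarrow> (nat \<Rightarrow> real) \<Rightarrow> nat \<Rightarrow> real" where
  "mala_prop g \<sigma> A x z i = x i + (if i \<in> A then \<sigma> * z i + \<sigma>\<^sup>2 / 2 * deriv g (x i) else 0)"

definition mala_ratio ::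
  "(real \<Rightarrow> real) \<Rightarrow> nat \<Rightarrow> real \<Rightarrow> nat set \<Rightarrow> (nat \<Rightarrow> real) \<Rightarrow> (nat \<Rightarrow> real) \<Rightarrow> real" where
  "mala_ratio g d \<sigma> A x y =
     ((\<Prod>i<d. exp (g (y i))) * (\<Prod>i\<in>A. mala_q1 g \<sigma> (y i) (x i)))
     / ((\<Prod>i<d. exp (g (x i))) * (\<Prod>i\<in>A. mala_q1 g \<sigma> (x i) (y i)))"

text \<open>Average acceptance rate of MALA-within-Gibbs in dimension d updating m
  coordinates with step sigma: A uniform among the m-subsets of {0..<d},
  X ~ pi_d, Z i.i.d. N(0,1), all independent.\<close>
definition mala_accept :: "(real \<Rightarrow> real) \<Rightarrow> nat \<Rightarrow> nat \<Rightarrow> real \<Rightarrow> real" where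
  "mala_accept g d m \<sigma> =
     (let S = {A. A \<subseteq> {..<d} \<and> card A = m} in
      (\<Sum>A\<in>S. integral\<^sup>L
         ((\<Pi>\<^sub>M i\<in>{..<d}. density lborel (\<lambda>t. exp (g t)))
            \<Otimes>\<^sub>M (\<Pi>\<^sub>M i\<in>{..<d}. density lborel std_normal_density))
         (\<lambda>(x, z). min 1 (mala_ratio g d \<sigma> A x (mala_prop g \<sigma> A x z)))) / real (card S))"

end

theory Submission
  imports Defs
begin

text \<open>
  Under stationarity the log acceptance ratio is a sum of i.i.d. increments \<open>R\<close>, one per updated
  coordinate. Taylor expansion gives \<open>R / \<sigma>\<^sup>3 \<rightarrow> - z\<^sup>3 g''' / 12 - z g' g'' / 4\<close>, dominated by a
  polynomial; the second moment of this limit is \<open>\<kappa>\<^sup>2\<close> after one integration by parts.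
  The mean does not have to be expanded to order \<open>\<sigma>\<^sup>6\<close>: detailed balance gives
  \<open>E[e\<^sup>R F(- R)] = E[F(R)]\<close>, so \<open>E[e\<^sup>R] = 1\<close> and hence \<open>E R = - E[R\<^sup>2] / 2 + O(E\<bar>R\<bar>\<^sup>3)\<close>.
  Characteristic functions then show that the sum converges weakly to \<open>W \<sim> N(- s\<^sup>2 / 2, s\<^sup>2)\<close> with
  \<open>s = \<surd>c \<kappa> l\<^sup>3\<close>, and \<open>E[min 1 e\<^sup>W] = 2 \<Phi>(- s / 2)\<close>.
\<close>

section \<open>Probabilistic and analytic preliminaries\<close>

text \<open>One increment has size \<open>\<sigma> ^ 3\<close> and
  \<open>\<sigma> ^ 6 = l ^ 6 / d\<close>, so about c d of them have a total variance of order one,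
  while third moments of size \<open>\<sigma> ^ 9\<close> sum to a vanishing error. The mean is the
  obstacle: it is of the order of the variance and invisible in the leading term, which is odd in z
  and hence centred. The identity E[e^R] = 1 recovers it, provided that the Taylor error of exp is
  under control. Polynomial bounds on R give no moments of e^R. The error is therefore split by the
  sign of R, and detailed balance with F(r) = max(0, -r)^3 turns E[e^R max(0, R)^3] into
  E[max(0, -R)^3], from which the exponential has gone. A limit mean of exactly minus half the
  variance is also what makes the two halves of E[min 1 e^W] equal. The random subset enters only
  through its size, because the coordinates are i.i.d.\<close>

lemma integral_deriv_eq_0:
  fixes u u' :: "real \<Rightarrow> real"
  assumes deriv: "\<And>x. (u has_real_derivative u' x) (at x)"
    and cont: "continuous_on UNIV u'"
    and u: "integrable lborel u" and u': "integrable lborel u'"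
  shows "(\<integral>x. u' x \<partial>lborel) = 0"
proof -
  have [measurable]: "u' \<in> borel_measurable borel"
    using cont by (rule borel_measurable_continuous_onI)
  \<comment> \<open>Averaging over shifts t in [0,1] leaves the integral of \<open>u'\<close>
    unchanged. Integrating in t first gives u(1 + x) - u(x), which has integral 0 by translation
    invariance, so no decay of \<open>u\<close> at infinity has to be established.\<close>
  let ?f = "\<lambda>t x. u' (t + x) * indicator {0..1} t"
  have shift_int: "integrable lborel (\<lambda>x. h (t + x))" if "integrable lborel h" for t and h :: "real \<Rightarrow> real"
    using lborel_integrable_real_affine[of h 1 t] that by simp
  have shift: "(\<integral>x. h (t + x) \<partial>lborel) = (\<integral>x. h x \<partial>lborel)" for t and h :: "real \<Rightarrow> real"
    using lborel_integral_real_affine[of 1 h t] by simp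
  have ind: "(\<integral>t. c * indicator {0..1::real} t \<partial>lborel) = c" for c :: real
    by simp
  have int: "integrable (lborel \<Otimes>\<^sub>M lborel) (case_prod ?f)"
  proof (rule lborel_pair.Fubini_integrable)
    have "(\<lambda>t. \<integral>x. norm (case_prod ?f (t, x)) \<partial>lborel) =
        (\<lambda>t. (\<integral>x. \<bar>u' x\<bar> \<partial>lborel) * indicator {0..1} t)"
      using shift[of "\<lambda>x. \<bar>u' x\<bar>"] by (auto simp: abs_mult)
    then show "integrable lborel (\<lambda>t. \<integral>x. norm (case_prod ?f (t, x)) \<partial>lborel)"
      by (simp del: integrable_mult_left_iff)
    show "AE t in lborel. integrable lborel (\<lambda>x. case_prod ?f (t, x))"
      using shift_int[OF u'] by auto
  qed measurable
  have FTC: "(\<integral>t. ?f t x \<partial>lborel) = u (1 + x) - u x" for x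
  proof -
    have "(\<integral>t. u' (t + x) * indicator {0..1} t \<partial>lborel) = u (1 + x) - u (0 + x)"
    proof (rule integral_FTC_Icc_real)
      show "((\<lambda>t. u (t + x)) has_real_derivative u' (t + x)) (at t)" for t
        using deriv[of "t + x"] by (simp add: DERIV_shift)
      show "isCont (\<lambda>t. u' (t + x)) t" for t
        using cont by (intro isCont_o2[where f = "\<lambda>t. t + x" and g = u'])
          (auto simp: continuous_on_eq_continuous_at)
    qed simp
    then show ?thesis by simp
  qed
  have "(\<integral>x. u' x \<partial>lborel) = (\<integral>t. (\<integral>x. ?f t x \<partial>lborel) \<partial>lborel)"
    by (simp only: shift integral_mult_left_zero ind)
  also have "\<dots> = (\<integral>x. (\<integral>t. ?f t x \<partial>lborel) \<partial>lborel)"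
    by (rule lborel_pair.Fubini_integral[OF int, symmetric])
  also have "\<dots> = (\<integral>x. u (1 + x) - u x \<partial>lborel)"
    by (simp add: FTC)
  also have "\<dots> = 0"
    using shift_int[OF u, of 1] u shift[of u 1] by simp
  finally show ?thesis .
qed

section \<open>The acceptance probability of the Gaussian limit\<close>

lemma Phi_eq_integral: "Phi x = (\<integral>w. std_normal_density w * indicator {..x} w \<partial>lborel)"
proof -
  interpret prob_space "density lborel std_normal_density"
    by (rule prob_space_normal_density) simp
  have "Phi x = (\<integral>w. indicator {..x} w \<partial>density lborel std_normal_density)"
    unfolding Phi_def by simp
  also have "\<dots> = (\<integral>w. std_normal_density w * indicator {..x} w \<partial>lborel)"
    by (subst integral_density) auto
  finally show ?thesis .
qed

text \<open>The exponential reaches 1 at w = s/2. Above that point the standard density itself is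
  integrated; below it the factor exp(s w - s^2/2) moves the density to mean s. By symmetry,
  respectively translation, each half has mass \<open>Phi (- (s / 2))\<close>.\<close>

lemma expectation_min_one_exp_gaussian:
  fixes s :: real
  assumes s: "s > 0"
  shows "(\<integral>w. min 1 (exp (s * w - s\<^sup>2 / 2)) \<partial>density lborel std_normal_density) = 2 * Phi (- (s / 2))"
proof -
  let ?\<phi> = "std_normal_density"
  have split: "?\<phi> w * min 1 (exp (s * w - s\<^sup>2 / 2)) =
      ?\<phi> w * indicator {s/2..} w + ?\<phi> (w - s) * indicator {..<s/2} w" for w
  proof (cases "w \<ge> s / 2")
    case True
    then have "s * w \<ge> s * (s / 2)" using s by (intro mult_left_mono) auto
    then show ?thesis using True by (simp add: power2_eq_square)
  next
    case False
    then have "s * w \<le> s * (s / 2)" using s by (intro mult_left_mono) auto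
    then have "min 1 (exp (s * w - s\<^sup>2 / 2)) = exp (s * w - s\<^sup>2 / 2)"
      by (simp add: power2_eq_square)
    moreover have "?\<phi> w * exp (s * w - s\<^sup>2 / 2) = ?\<phi> (w - s)"
      unfolding std_normal_density_def
      by (simp add: exp_add[symmetric] power2_eq_square field_simps)
    ultimately show ?thesis using False by simp
  qed
  have \<phi>_int: "integrable lborel ?\<phi>"
    by (rule integrable_normal_density) simp
  have int: "integrable lborel (\<lambda>w. ?\<phi> w * indicator A w)" if "A \<in> sets borel" for A
    using integrable_real_mult_indicator[OF _ \<phi>_int, of A] that by simp
  have eq2: "(\<lambda>v. ?\<phi> (s + 1 * v - s) * indicator {..<s/2} (s + 1 * v)) =
     (\<lambda>v. ?\<phi> v * indicator {..<-(s/2)} v)"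
    by (auto simp: indicator_def)
  have int2: "integrable lborel (\<lambda>w. ?\<phi> (w - s) * indicator {..<s/2} w)"
    using lborel_integrable_real_affine_iff[of 1 "\<lambda>w. ?\<phi> (w - s) * indicator {..<s/2} w" s]
    unfolding eq2 by (simp add: int)
  have "(\<integral>w. min 1 (exp (s * w - s\<^sup>2 / 2)) \<partial>density lborel ?\<phi>) =
      (\<integral>w. ?\<phi> w * min 1 (exp (s * w - s\<^sup>2 / 2)) \<partial>lborel)"
    by (subst integral_density) auto
  also have "\<dots> = (\<integral>w. ?\<phi> w * indicator {s/2..} w \<partial>lborel) + (\<integral>w. ?\<phi> (w - s) * indicator {..<s/2} w \<partial>lborel)"
    unfolding split using int int2 by (intro Bochner_Integration.integral_add) auto
  also have "(\<integral>w. ?\<phi> w * indicator {s/2..} w \<partial>lborel) = Phi (- (s / 2))"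
    unfolding Phi_eq_integral
    by (subst lborel_integral_real_affine[of "-1" _ 0])
      (auto intro!: Bochner_Integration.integral_cong simp: indicator_def std_normal_density_def)
  also have "(\<integral>w. ?\<phi> (w - s) * indicator {..<s/2} w \<partial>lborel) = (\<integral>v. ?\<phi> v * indicator {..<-(s/2)} v \<partial>lborel)"
    by (subst lborel_integral_real_affine[of 1 _ s]) (simp_all add: eq2[simplified])
  also have "\<dots> = Phi (- (s / 2))"
    unfolding Phi_eq_integral
    by (intro integral_cong_AE eventually_mono[OF AE_lborel_singleton[of "-(s/2)"]])
      (auto simp: indicator_def)
  finally show ?thesis by simp
qed

section \<open>Characteristic functions of sums of many small i.i.d. terms\<close>

lemma power_tendsto_exp:
  fixes \<phi> :: "nat \<Rightarrow> complex" and u :: complex and v e :: "nat \<Rightarrow> real" and m :: "nat \<Rightarrow> nat"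
  assumes norm: "\<And>n. cmod (\<phi> n) \<le> 1" and u: "Re u \<le> 0" and v: "\<And>n. 0 \<le> v n"
    and approx: "\<forall>\<^sub>F n in sequentially. cmod (\<phi> n - (1 + v n * u)) \<le> e n"
    and mv: "(\<lambda>n. m n * v n) \<longlonglongrightarrow> V" and v0: "v \<longlonglongrightarrow> 0"
    and me: "(\<lambda>n. m n * e n) \<longlonglongrightarrow> 0"
  shows "(\<lambda>n. \<phi> n ^ m n) \<longlonglongrightarrow> exp (of_real V * u)"
proof -
  have Re: "Re (of_real (v n) * u) \<le> 0" for n
    using u v[of n] by (simp add: mult_nonneg_nonpos)
  have exp1: "cmod (exp (v n * u) - (1 + v n * u)) \<le> exp \<bar>v n * Re u\<bar> * (v n * cmod u)\<^sup>2" for n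
    using Taylor_exp[of "of_real (v n) * u" 1] v[of n] by (simp add: norm_mult power2_eq_square)
  \<comment> \<open>The comparison is with \<open>exp (v n * u)\<close> and not with 1 + v u: its
    powers are explicit, and its modulus is at most 1 because Re u \<le> 0. For two numbers in the
    unit disc the m-th powers differ by at most m times the difference of the bases.\<close>
  have diff: "cmod (\<phi> n ^ m n - exp (v n * u) ^ m n)
      \<le> m n * e n + exp \<bar>v n * Re u\<bar> * (m n * v n) * v n * (cmod u)\<^sup>2"
    if "cmod (\<phi> n - (1 + v n * u)) \<le> e n" for n
  proof -
    have "cmod (\<phi> n ^ m n - exp (v n * u) ^ m n) \<le> m n * cmod (\<phi> n - exp (v n * u))"
      using norm Re by (intro norm_power_diff) simp_all
    also have "cmod (\<phi> n - exp (v n * u)) \<le> e n + exp \<bar>v n * Re u\<bar> * (v n * cmod u)\<^sup>2"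
      using norm_triangle_sub[of "\<phi> n - (1 + v n * u)" "exp (v n * u) - (1 + v n * u)"]
        norm_triangle_ineq4[of "\<phi> n - (1 + v n * u)" "exp (v n * u) - (1 + v n * u)"]
        that exp1[of n] by simp
    finally have "cmod (\<phi> n ^ m n - exp (v n * u) ^ m n)
        \<le> m n * (e n + exp \<bar>v n * Re u\<bar> * (v n * cmod u)\<^sup>2)"
      by (simp add: mult_left_mono)
    then show ?thesis
      by (simp add: algebra_simps power2_eq_square)
  qed
  have "(\<lambda>n. m n * e n + exp \<bar>v n * Re u\<bar> * (m n * v n) * v n * (cmod u)\<^sup>2)
      \<longlonglongrightarrow> 0 + exp \<bar>0 * Re u\<bar> * V * 0 * (cmod u)\<^sup>2"
    by (intro tendsto_intros mv v0 me)
  then have "(\<lambda>n. m n * e n + exp \<bar>v n * Re u\<bar> * (m n * v n) * v n * (cmod u)\<^sup>2) \<longlonglongrightarrow> 0"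
    by simp
  then have lim0: "(\<lambda>n. \<phi> n ^ m n - exp (v n * u) ^ m n) \<longlonglongrightarrow> 0"
    by (rule Lim_null_comparison[rotated]) (rule eventually_mono[OF approx diff])
  have "(\<lambda>n. exp (v n * u) ^ m n) \<longlonglongrightarrow> exp (of_real V * u)"
  proof -
    have "(\<lambda>n. exp (of_real (m n * v n) * u)) \<longlonglongrightarrow> exp (of_real V * u)"
      by (intro tendsto_intros mv)
    then show ?thesis by (simp add: exp_of_nat_mult[symmetric] mult.assoc)
  qed
  from tendsto_add[OF lim0 this] show ?thesis
    by simp
qed

text \<open>The bound keeps the factor \<open>exp r\<close> on the positive side only. This is the
  shape in which detailed balance, applied to the cube of the negative part, removes the
  exponential.\<close>

lemma exp_Taylor2_error:
  fixes r :: real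
  shows "\<bar>exp r - 1 - r - r\<^sup>2 / 2\<bar> \<le> (max 0 (- r) ^ 3 + exp r * max 0 r ^ 3) / 6"
proof -
  obtain t where t: "\<bar>t\<bar> \<le> \<bar>r\<bar>" "exp r = (\<Sum>m<3. r ^ m / fact m) + exp t / fact 3 * r ^ 3"
    using Maclaurin_exp_le[of r 3] by blast
  then have eq: "exp r - 1 - r - r\<^sup>2 / 2 = exp t * r ^ 3 / 6"
    by (simp add: numeral_3_eq_3 fact_numeral power2_eq_square)
  show ?thesis
  proof (cases "r \<ge> 0")
    case True
    then show ?thesis using t(1) unfolding eq by (simp add: abs_mult mult_right_mono)
  next
    case False
    \<comment> \<open>A sharper location of the intermediate point is required here: between r and
      0, so that exp t \<le> 1. The bound |t| \<le> |r| alone would leave a factor exp |r|.\<close>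
    then obtain t where "t < 0" "exp r = (\<Sum>m<3. exp 0 / fact m * (r - 0) ^ m) + exp t / fact 3 * (r - 0) ^ 3"
      using Taylor_down[of 3 "\<lambda>_. exp" exp r 0 0] by auto
    then have "t < 0" "exp r - 1 - r - r\<^sup>2 / 2 = exp t * r ^ 3 / 6"
      by (simp_all add: numeral_3_eq_3 fact_numeral power2_eq_square)
    moreover have "exp t * \<bar>r\<bar> ^ 3 \<le> \<bar>r\<bar> ^ 3"
      using \<open>t < 0\<close> by (simp add: mult_left_le_one_le)
    ultimately show ?thesis using False
      by (simp only: abs_mult power_abs abs_divide) simp
  qed
qed

lemma (in prob_space) integrable_lower_powers:
  fixes R :: "'a \<Rightarrow> real"
  assumes [measurable]: "R \<in> borel_measurable M" and R3: "integrable M (\<lambda>w. \<bar>R w\<bar> ^ 3)"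
  shows "integrable M R" "integrable M (\<lambda>w. (R w)\<^sup>2)"
proof -
  have le: "\<bar>r\<bar> \<le> 1 + \<bar>r\<bar> ^ 3" "\<bar>r\<bar>\<^sup>2 \<le> 1 + \<bar>r\<bar> ^ 3" for r :: real
  proof -
    consider "\<bar>r\<bar> \<le> 1" | "\<bar>r\<bar> \<ge> 1" by linarith
    then have "\<bar>r\<bar> \<le> 1 + \<bar>r\<bar> ^ 3 \<and> \<bar>r\<bar>\<^sup>2 \<le> 1 + \<bar>r\<bar> ^ 3"
    proof cases
      case 1
      then have "\<bar>r\<bar>\<^sup>2 \<le> 1" by (metis abs_ge_zero power_le_one)
      with 1 show ?thesis by (simp add: add_increasing2)
    next
      case 2
      then show ?thesis
        using power_increasing[of 1 3 "\<bar>r\<bar>"] power_increasing[of 2 3 "\<bar>r\<bar>"] by simp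
    qed
    then show "\<bar>r\<bar> \<le> 1 + \<bar>r\<bar> ^ 3" "\<bar>r\<bar>\<^sup>2 \<le> 1 + \<bar>r\<bar> ^ 3" by auto
  qed
  have *: "integrable M (\<lambda>w. 1 + \<bar>R w\<bar> ^ 3)"
    using R3 by simp
  show "integrable M R"
    using le(1) by (intro Bochner_Integration.integrable_bound[OF *]) auto
  show "integrable M (\<lambda>w. (R w)\<^sup>2)"
    using le(2) by (intro Bochner_Integration.integrable_bound[OF *]) auto
qed

text \<open>The second-order expansion contains the mean, which \<open>mean\<close> replaces by
  minus half the second moment. The bracket is then, per unit of variance, the exponent of a
  Gaussian whose mean is minus half its variance. The term |t|^3/6 is the Taylor remainder of
  \<open>iexp\<close>, and |t|/3 comes from the error in the mean.\<close>

lemma (in prob_space) char_expansion: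
  fixes R :: "'a \<Rightarrow> real" and t :: real
  assumes [measurable]: "R \<in> borel_measurable M" and R3: "integrable M (\<lambda>w. \<bar>R w\<bar> ^ 3)"
    and mean: "\<bar>expectation R + expectation (\<lambda>w. (R w)\<^sup>2) / 2\<bar> \<le> expectation (\<lambda>w. \<bar>R w\<bar> ^ 3) / 3"
  shows "cmod ((CLINT w|M. iexp (t * R w)) -
      (1 + expectation (\<lambda>w. (R w)\<^sup>2) * (- (\<i> * t / 2) - t\<^sup>2 / 2)))
    \<le> (\<bar>t\<bar> ^ 3 / 6 + \<bar>t\<bar> / 3) * expectation (\<lambda>w. \<bar>R w\<bar> ^ 3)"
proof -
  note R1 = integrable_lower_powers(1)[OF assms(1) R3]
  note R2 = integrable_lower_powers(2)[OF assms(1) R3]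
  let ?v = "expectation (\<lambda>w. (R w)\<^sup>2)" and ?m = "expectation (\<lambda>w. \<bar>R w\<bar> ^ 3)"
  let ?p = "\<lambda>w. 1 + \<i> * t * R w - of_real (t\<^sup>2 / 2 * (R w)\<^sup>2) :: complex"
  have int_e: "complex_integrable M (\<lambda>w. iexp (t * R w))"
    by (rule integrable_const_bound[of _ 1]) auto
  have int_R: "complex_integrable M (\<lambda>w. of_real (R w))"
    "complex_integrable M (\<lambda>w. of_real (t\<^sup>2 / 2 * (R w)\<^sup>2))"
    by (intro integrable_of_real integrable_mult_right R1 R2)+
  have int_p: "complex_integrable M ?p"
    using int_R by (intro Bochner_Integration.integrable_add Bochner_Integration.integrable_diff
        integrable_mult_right) auto
  have p: "(CLINT w|M. ?p w) = 1 + \<i> * t * expectation R - of_real (t\<^sup>2 / 2 * ?v)"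
  proof -
    have "(CLINT w|M. ?p w) = (CLINT w|M. 1) + (CLINT w|M. \<i> * t * R w) - (CLINT w|M. of_real (t\<^sup>2 / 2 * (R w)\<^sup>2))"
      using int_R by (subst Bochner_Integration.integral_diff Bochner_Integration.integral_add; simp)+
    then show ?thesis
      by (simp only: integral_mult_right_zero integral_of_real) (simp add: prob_space del: of_real_mult of_real_power of_real_divide)
  qed
  have "cmod (iexp (t * r) - (1 + \<i> * t * r - of_real (t\<^sup>2 / 2 * r\<^sup>2))) \<le> \<bar>t\<bar> ^ 3 / 6 * \<bar>r\<bar> ^ 3" for r
  proof -
    have "(\<Sum>k\<le>2. (\<i> * complex_of_real (t * r)) ^ k / fact k) = 1 + \<i> * t * r - of_real (t\<^sup>2 / 2 * r\<^sup>2)"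
      by (simp add: numeral_2_eq_2 power2_eq_square algebra_simps)
    then show ?thesis
      using iexp_approx1[of "t * r" 2] by (simp add: fact_numeral abs_mult power_mult_distrib)
  qed
  then have "cmod (CLINT w|M. iexp (t * R w) - ?p w) \<le> expectation (\<lambda>w. \<bar>t\<bar> ^ 3 / 6 * \<bar>R w\<bar> ^ 3)"
    using R3 int_e int_p by (intro order_trans[OF integral_norm_bound integral_mono]) auto
  then have 1: "cmod ((CLINT w|M. iexp (t * R w)) - (CLINT w|M. ?p w)) \<le> \<bar>t\<bar> ^ 3 / 6 * ?m"
    using int_e int_p by simp
  have "(CLINT w|M. ?p w) - (1 + ?v * (- (\<i> * t / 2) - t\<^sup>2 / 2)) = \<i> * of_real (t * (expectation R + ?v / 2))"
    unfolding p by (simp add: field_simps)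
  then have 2: "cmod ((CLINT w|M. ?p w) - (1 + ?v * (- (\<i> * t / 2) - t\<^sup>2 / 2))) \<le> \<bar>t\<bar> / 3 * ?m"
    using mult_left_mono[OF mean, of "\<bar>t\<bar>"] by (simp add: norm_mult abs_mult del: of_real_mult of_real_add)
  show ?thesis
    using norm_triangle_mono[OF 1 2] by (simp add: algebra_simps)
qed

section \<open>Taylor remainders, polynomial growth and product integrals\<close>

lemma Taylor_between:
  fixes diff :: "nat \<Rightarrow> real \<Rightarrow> real"
  assumes n: "n > 0" and deriv: "\<And>m t. m < n \<Longrightarrow> DERIV (diff m) t :> diff (Suc m) t"
  shows "\<exists>t. \<bar>t - c\<bar> \<le> \<bar>x - c\<bar> \<and>
    diff 0 x = (\<Sum>m<n. diff m c / fact m * (x - c) ^ m) + diff n t / fact n * (x - c) ^ n"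
proof (cases "x = c")
  case True
  obtain k where k: "n = Suc k" using n by (cases n) auto
  show ?thesis
    by (rule exI[of _ c]) (simp add: True k sum.lessThan_Suc_shift)
next
  case False
  then obtain t where "if x < c then x < t \<and> t < c else c < t \<and> t < x"
    "diff 0 x = (\<Sum>m<n. diff m c / fact m * (x - c) ^ m) + diff n t / fact n * (x - c) ^ n"
    using Taylor[of n diff "diff 0" "min x c" "max x c" c x] n deriv by auto
  then show ?thesis
    by (intro exI[of _ t]) (auto split: if_splits)
qed

lemma integrable_density_one_plus_abs_power:
  fixes f :: "real \<Rightarrow> real"
  assumes [measurable]: "f \<in> borel_measurable borel" and nonneg: "\<And>x. 0 \<le> f x"
    and int: "\<And>k. integrable lborel (\<lambda>x. f x * \<bar>x\<bar> ^ k)"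
  shows "integrable (density lborel f) (\<lambda>x. (1 + \<bar>x\<bar>) ^ n)"
proof -
  have "(\<lambda>x. f x * (1 + \<bar>x\<bar>) ^ n) = (\<lambda>x. \<Sum>k\<le>n. of_nat (n choose k) * (f x * \<bar>x\<bar> ^ k))"
    by (simp add: add.commute[of 1] binomial_ring sum_distrib_left mult_ac)
  then have "integrable lborel (\<lambda>x. f x * (1 + \<bar>x\<bar>) ^ n)"
    using int by simp
  then show ?thesis
    by (subst integrable_density) (auto simp: nonneg)
qed

text \<open>The base 1 + |x| is at least 1 and exponents add under products, so integrability
  against the target reduces to closure under multiplication.\<close>

definition poly_bounded :: "(real \<Rightarrow> real) \<Rightarrow> bool" where
  "poly_bounded p \<longleftrightarrow> (\<exists>C n. \<forall>x. \<bar>p x\<bar> \<le> C * (1 + \<bar>x\<bar>) ^ n)"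

lemma poly_bounded_mult:
  assumes "poly_bounded p" "poly_bounded q"
  shows "poly_bounded (\<lambda>x. p x * q x)"
proof -
  obtain C n D m where *: "\<And>x. \<bar>p x\<bar> \<le> C * (1 + \<bar>x\<bar>) ^ n" "\<And>x. \<bar>q x\<bar> \<le> D * (1 + \<bar>x\<bar>) ^ m"
    using assms unfolding poly_bounded_def by blast
  have "\<bar>p x * q x\<bar> \<le> C * D * (1 + \<bar>x\<bar>) ^ (n + m)" for x
  proof -
    have "\<bar>p x\<bar> * \<bar>q x\<bar> \<le> (C * (1 + \<bar>x\<bar>) ^ n) * (D * (1 + \<bar>x\<bar>) ^ m)"
      using *[of x] by (intro mult_mono) (auto intro: order_trans[OF abs_ge_zero])
    then show ?thesis by (simp add: abs_mult power_add mult_ac)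
  qed
  then show ?thesis unfolding poly_bounded_def by blast
qed

text \<open>The zero set is closed and of full measure, hence the whole line. This turns a vanishing
  second moment into pointwise differential equations for g.\<close>

lemma AE_lborel_continuous_zero:
  fixes f :: "real \<Rightarrow> real"
  assumes "continuous_on UNIV f" "AE x in lborel. f x = 0"
  shows "f x = 0"
proof -
  have "closed {x. f x = 0}"
    using assms(1) continuous_closed_preimage_constant[of UNIV f 0] by simp
  moreover have "AE x in lebesgue. x \<in> {x. f x = 0}"
    using AE_completion[OF assms(2)] by simp
  ultimately show ?thesis
    using mem_closed_if_AE_lebesgue by blast
qed

text \<open>States and noises live on two separate product spaces, although independence is across
  the pairs (x_i, z_i). Fubini freezes x, the z-integral factorises, then the x-integral does, and
  each factor is reassembled into an integral over one pair. The bound by 1 supplies integrability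
  at every stage.\<close>

lemma integral_prod_pair_PiM:
  fixes h :: "'i \<Rightarrow> 'a \<times> 'b \<Rightarrow> complex"
  assumes M: "prob_space M" and N: "prob_space N" and I: "finite I"
    and h[measurable]: "\<And>i. h i \<in> borel_measurable (M \<Otimes>\<^sub>M N)"
    and bound: "\<And>i w. cmod (h i w) \<le> 1"
  shows "(CLINT w|PiM I (\<lambda>_. M) \<Otimes>\<^sub>M PiM I (\<lambda>_. N). \<Prod>i\<in>I. h i (fst w i, snd w i)) =
    (\<Prod>i\<in>I. CLINT w|M \<Otimes>\<^sub>M N. h i w)"
proof -
  interpret M: prob_space M by fact
  interpret N: prob_space N by fact
  interpret MN: pair_prob_space M N ..
  interpret PM: product_prob_space "\<lambda>_. M" I ..
  interpret PN: product_prob_space "\<lambda>_. N" I ..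
  interpret P: pair_prob_space "PiM I (\<lambda>_. M)" "PiM I (\<lambda>_. N)" ..
  have prod_bound: "cmod (\<Prod>i\<in>I. f i) \<le> 1" if "\<And>i. cmod (f i) \<le> 1" for f :: "'i \<Rightarrow> complex"
    unfolding prod_norm[symmetric] using that by (intro prod_le_1) auto
  have int_P: "complex_integrable (PiM I (\<lambda>_. M) \<Otimes>\<^sub>M PiM I (\<lambda>_. N)) (\<lambda>w. \<Prod>i\<in>I. h i (fst w i, snd w i))"
    by (rule P.integrable_const_bound[of _ 1]) (auto intro!: prod_bound bound)
  have int_h: "complex_integrable (M \<Otimes>\<^sub>M N) (h i)" for i
    by (rule MN.integrable_const_bound[of _ 1]) (auto intro!: bound)
  have int_N: "complex_integrable N (\<lambda>z. h i (x, z))" if "x \<in> space M" for i x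
    using that by (intro N.integrable_const_bound[of _ 1]) (auto intro!: bound)
  have "(CLINT w|PiM I (\<lambda>_. M) \<Otimes>\<^sub>M PiM I (\<lambda>_. N). \<Prod>i\<in>I. h i (fst w i, snd w i)) =
     (CLINT x|PiM I (\<lambda>_. M). CLINT z|PiM I (\<lambda>_. N). \<Prod>i\<in>I. h i (x i, z i))"
    using P.integral_fst'[OF int_P] by simp
  also have "\<dots> = (CLINT x|PiM I (\<lambda>_. M). \<Prod>i\<in>I. CLINT z|N. h i (x i, z))"
    using I int_N
    by (intro Bochner_Integration.integral_cong refl PN.product_integral_prod) (auto simp: space_PiM)
  also have "\<dots> = (\<Prod>i\<in>I. CLINT x|M. CLINT z|N. h i (x, z))"
    using I int_h by (intro PM.product_integral_prod MN.integrable_fst') auto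
  also have "\<dots> = (\<Prod>i\<in>I. CLINT w|M \<Otimes>\<^sub>M N. h i w)"
    using int_h by (intro prod.cong refl MN.integral_fst') auto
  finally show ?thesis .
qed

lemma char_shifted_gaussian:
  "char (distr std_normal_distribution borel (\<lambda>w. s * w - s\<^sup>2 / 2)) t =
    exp (of_real (s\<^sup>2) * (- (\<i> * t / 2) - t\<^sup>2 / 2))"
proof -
  have "char (distr std_normal_distribution borel (\<lambda>w. s * w - s\<^sup>2 / 2)) t =
      (CLINT w|std_normal_distribution. iexp (t * (s * w - s\<^sup>2 / 2)))"
    unfolding char_def by (subst integral_distr) auto
  also have "\<dots> = (CLINT w|std_normal_distribution. iexp (- (t * s\<^sup>2 / 2)) * iexp ((t * s) * w))"
    by (simp add: exp_add[symmetric] algebra_simps)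
  also have "\<dots> = iexp (- (t * s\<^sup>2 / 2)) * char std_normal_distribution (t * s)"
    unfolding char_def by simp
  also have "\<dots> = exp (of_real (s\<^sup>2) * (- (\<i> * t / 2) - t\<^sup>2 / 2))"
    unfolding char_std_normal_distribution
    by (simp add: exp_of_real[symmetric] exp_add[symmetric] algebra_simps power2_eq_square del: exp_of_real)
  finally show ?thesis .
qed

section \<open>The log acceptance ratio of MALA\<close>

text \<open>The setting in which the asymptotics are carried out. The growth exponent is a natural
  number, so that bounds multiply without real powers, and \<open>moments\<close> at k = 0 is the
  integrability of the density itself.\<close>

locale mala_target =
  fixes g g1 g2 g3 :: "real \<Rightarrow> real"
  assumes deriv_g: "\<And>x. (g has_real_derivative g1 x) (at x)"
    and deriv_g1: "\<And>x. (g1 has_real_derivative g2 x) (at x)"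
    and deriv_g2: "\<And>x. (g2 has_real_derivative g3 x) (at x)"
    and cont_g3: "continuous_on UNIV g3"
    and growth: "\<exists>C N. \<forall>x. \<bar>g1 x\<bar> \<le> C * (1 + \<bar>x\<bar>) ^ N \<and> \<bar>g2 x\<bar> \<le> C * (1 + \<bar>x\<bar>) ^ N
      \<and> \<bar>g3 x\<bar> \<le> C * (1 + \<bar>x\<bar>) ^ N"
    and moments: "\<And>k. integrable lborel (\<lambda>x. \<bar>x\<bar> ^ k * exp (g x))"
    and total_mass: "(\<integral>x. exp (g x) \<partial>lborel) = 1"
begin

lemma cont: "continuous_on UNIV g" "continuous_on UNIV g1" "continuous_on UNIV g2"
  using deriv_g deriv_g1 deriv_g2 DERIV_continuous_on[of UNIV g g1] DERIV_continuous_on[of UNIV g1 g2]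
    DERIV_continuous_on[of UNIV g2 g3] by simp_all

lemma measurable_g[measurable]:
  "g \<in> borel_measurable borel" "g1 \<in> borel_measurable borel"
  "g2 \<in> borel_measurable borel" "g3 \<in> borel_measurable borel"
  using cont cont_g3 by (auto intro: borel_measurable_continuous_onI)

abbreviation target :: "real measure" where
  "target \<equiv> density lborel (\<lambda>x. ennreal (exp (g x)))"

abbreviation noise :: "real measure" where
  "noise \<equiv> density lborel (\<lambda>x. ennreal (std_normal_density x))"

abbreviation pair :: "(real \<times> real) measure" where
  "pair \<equiv> target \<Otimes>\<^sub>M noise"

definition step :: "real \<Rightarrow> real \<Rightarrow> real \<Rightarrow> real" where
  "step \<sigma> x z = x + (\<sigma> * z + \<sigma>\<^sup>2 / 2 * g1 x)"

text \<open>The logarithm of \<open>f(y) q(y,x) / (f(x) q(x,y))\<close> with the normalising constants cancelled.\<close>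
definition log_ratio :: "real \<Rightarrow> real \<Rightarrow> real \<Rightarrow> real" where
  "log_ratio \<sigma> x y = g y - g x - (y - x) * (g1 x + g1 y) / 2 - \<sigma>\<^sup>2 / 8 * ((g1 y)\<^sup>2 - (g1 x)\<^sup>2)"

definition incr :: "real \<Rightarrow> real \<times> real \<Rightarrow> real" where
  "incr \<sigma> w = log_ratio \<sigma> (fst w) (step \<sigma> (fst w) (snd w))"

text \<open>In \<open>log_ratio\<close> the terms without \<open>\<sigma>\<close> are the error of
  the trapezoidal rule for g' on [x, y]; its coefficient is 1/6 - 1/4 = -1/12. The second term is
  -1/8 times the derivative 2 g' g'' of the squared drift, times z.\<close>

definition lead :: "real \<times> real \<Rightarrow> real" where
  "lead w = - (snd w ^ 3 * g3 (fst w) / 12) - snd w * (g1 (fst w) * g2 (fst w)) / 4"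

lemma prob_space_target: "prob_space target"
proof
  have "integrable lborel (\<lambda>x. exp (g x))" using moments[of 0] by simp
  then have "(\<integral>\<^sup>+x. ennreal (exp (g x)) \<partial>lborel) = 1"
    by (simp add: nn_integral_eq_integral total_mass)
  then show "emeasure target (space target) = 1"
    by (simp add: emeasure_density)
qed

lemma prob_space_noise: "prob_space noise"
  by (rule prob_space_normal_density) simp

sublocale T: prob_space target by (rule prob_space_target)
sublocale Z: prob_space noise by (rule prob_space_noise)
sublocale TZ: pair_prob_space target noise ..

subsection \<open>Detailed balance\<close>

lemma log_ratio_antisym: "log_ratio \<sigma> y x = - log_ratio \<sigma> x y"
  unfolding log_ratio_def by (simp add: field_simps)

lemma measurable_log_ratio[measurable]:
  "(\<lambda>w. log_ratio \<sigma> (fst w) (snd w)) \<in> borel_measurable (borel \<Otimes>\<^sub>M borel)"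
  unfolding log_ratio_def by measurable

lemma measurable_step[measurable]: "step \<sigma> x \<in> borel_measurable borel"
  unfolding step_def by measurable

lemma measurable_incr[measurable]: "incr \<sigma> \<in> borel_measurable (borel \<Otimes>\<^sub>M borel)"
  unfolding incr_def log_ratio_def step_def by measurable

lemma measurable_lead[measurable]: "lead \<in> borel_measurable (borel \<Otimes>\<^sub>M borel)"
  unfolding lead_def by measurable

lemma sets_pair[measurable_cong]: "sets pair = sets (borel \<Otimes>\<^sub>M borel)"
  by (intro sets_pair_measure_cong) auto

lemma deriv_g_eq: "deriv g = g1"
  using deriv_g by (auto intro: DERIV_imp_deriv)

lemma measurable_q1[measurable]:
  "(\<lambda>w. mala_q1 g \<sigma> (fst w) (snd w)) \<in> borel_measurable (borel \<Otimes>\<^sub>M borel)"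
  unfolding mala_q1_def normal_density_def deriv_g_eq by measurable

lemma q1_log_ratio:
  assumes "\<sigma> \<noteq> 0"
  shows "exp (g y) * mala_q1 g \<sigma> y x = exp (g x) * mala_q1 g \<sigma> x y * exp (log_ratio \<sigma> x y)"
proof -
  have "g y + - (x - (y + \<sigma>\<^sup>2 / 2 * g1 y))\<^sup>2 / (2 * \<sigma>\<^sup>2) =
      g x + - (y - (x + \<sigma>\<^sup>2 / 2 * g1 x))\<^sup>2 / (2 * \<sigma>\<^sup>2) + log_ratio \<sigma> x y"
  proof -
    \<comment> \<open>With a = y - x, both Gaussian exponents contain the same term in a^2, which
      cancels. The cross terms produce the trapezoidal part of \<open>log_ratio\<close> and the
      terms in b^2 its last part.\<close>
    have sq: "- (a + s / 2 * b)\<^sup>2 / (2 * s) = - (a\<^sup>2 / (2 * s)) - a * b / 2 - s * b\<^sup>2 / 8"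
      if "s \<noteq> 0" for a b s :: real
      using that by (simp add: field_simps power2_eq_square)
    have "(x - (y + \<sigma>\<^sup>2 / 2 * g1 y))\<^sup>2 = ((y - x) + \<sigma>\<^sup>2 / 2 * g1 y)\<^sup>2"
      "(y - (x + \<sigma>\<^sup>2 / 2 * g1 x))\<^sup>2 = ((y - x) + \<sigma>\<^sup>2 / 2 * (- g1 x))\<^sup>2"
      by (simp_all add: power2_eq_square algebra_simps)
    then show ?thesis
      using assms sq[of "\<sigma>\<^sup>2" "y - x" "g1 y"] sq[of "\<sigma>\<^sup>2" "y - x" "- g1 x"]
      unfolding log_ratio_def by (simp add: ring_distribs add_divide_distrib diff_divide_distrib)
  qed
  then have "exp (g y) * exp (- (x - (y + \<sigma>\<^sup>2 / 2 * g1 y))\<^sup>2 / (2 * \<sigma>\<^sup>2)) =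
      exp (g x) * exp (- (y - (x + \<sigma>\<^sup>2 / 2 * g1 x))\<^sup>2 / (2 * \<sigma>\<^sup>2)) * exp (log_ratio \<sigma> x y)"
    by (simp only: exp_add[symmetric])
  then show ?thesis
    unfolding mala_q1_def normal_density_def deriv_g_eq by simp
qed

text \<open>Substituting the proposal y for the noise z, with Jacobian \<open>\<sigma>\<close>,
  gives an integral against f(x) q(x,y), where x and y can be exchanged. Nonnegative integrals avoid
  any integrability condition on \<open>F\<close>.\<close>

lemma nn_integral_incr_density:
  assumes \<sigma>: "\<sigma> > 0" and [measurable]: "F \<in> borel_measurable borel"
  shows "(\<integral>\<^sup>+w. F (incr \<sigma> w) \<partial>pair) =
    (\<integral>\<^sup>+x. \<integral>\<^sup>+y. ennreal (exp (g x) * mala_q1 g \<sigma> x y) * F (log_ratio \<sigma> x y) \<partial>lborel \<partial>lborel)"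
proof -
  have lr_meas[measurable]: "(\<lambda>y. log_ratio \<sigma> x y) \<in> borel_measurable borel" for x
    unfolding log_ratio_def by measurable
  have q1_meas'[measurable]: "(\<lambda>y. mala_q1 g \<sigma> x y) \<in> borel_measurable borel" for x
    unfolding mala_q1_def by measurable
  have sub: "(\<integral>\<^sup>+z. ennreal (std_normal_density z) * F (log_ratio \<sigma> x (step \<sigma> x z)) \<partial>lborel) =
      (\<integral>\<^sup>+y. ennreal (mala_q1 g \<sigma> x y) * F (log_ratio \<sigma> x y) \<partial>lborel)" for x
  proof -
    have dens: "\<sigma> * mala_q1 g \<sigma> x (step \<sigma> x z) = std_normal_density z" for z
      using \<sigma> unfolding mala_q1_def normal_density_def deriv_g_eq step_def
      by (simp add: real_sqrt_mult field_simps power2_eq_square)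
    have "(\<integral>\<^sup>+y. ennreal (mala_q1 g \<sigma> x y) * F (log_ratio \<sigma> x y) \<partial>lborel) =
        ennreal \<sigma> * (\<integral>\<^sup>+z. ennreal (mala_q1 g \<sigma> x ((x + \<sigma>\<^sup>2 / 2 * g1 x) + \<sigma> * z)) *
          F (log_ratio \<sigma> x ((x + \<sigma>\<^sup>2 / 2 * g1 x) + \<sigma> * z)) \<partial>lborel)"
      using \<sigma> by (subst nn_integral_real_affine[where c = \<sigma> and t = "x + \<sigma>\<^sup>2 / 2 * g1 x"]) auto
    also have "\<dots> = ennreal \<sigma> * (\<integral>\<^sup>+z. ennreal (mala_q1 g \<sigma> x (step \<sigma> x z)) *
          F (log_ratio \<sigma> x (step \<sigma> x z)) \<partial>lborel)"
      unfolding step_def by (simp add: algebra_simps)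
    also have "\<dots> = (\<integral>\<^sup>+z. ennreal (\<sigma> * mala_q1 g \<sigma> x (step \<sigma> x z)) *
          F (log_ratio \<sigma> x (step \<sigma> x z)) \<partial>lborel)"
      using \<sigma> unfolding step_def
      by (subst nn_integral_cmult[symmetric]) (auto simp: ennreal_mult' mult.assoc)
    finally show ?thesis by (simp add: dens)
  qed
  have "(\<integral>\<^sup>+w. F (incr \<sigma> w) \<partial>pair) = (\<integral>\<^sup>+x. (\<integral>\<^sup>+z. F (incr \<sigma> (x, z)) \<partial>noise) \<partial>target)"
    by (subst Z.nn_integral_fst[symmetric]) auto
  also have "\<dots> = (\<integral>\<^sup>+x. (\<integral>\<^sup>+z. ennreal (std_normal_density z) * F (log_ratio \<sigma> x (step \<sigma> x z)) \<partial>lborel) \<partial>target)"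
    by (intro nn_integral_cong) (subst nn_integral_density, auto simp: incr_def)
  also have "\<dots> = (\<integral>\<^sup>+x. ennreal (exp (g x)) * (\<integral>\<^sup>+y. ennreal (mala_q1 g \<sigma> x y) * F (log_ratio \<sigma> x y) \<partial>lborel) \<partial>lborel)"
    unfolding sub
    by (subst nn_integral_density) auto
  also have "\<dots> = (\<integral>\<^sup>+x. \<integral>\<^sup>+y. ennreal (exp (g x) * mala_q1 g \<sigma> x y) * F (log_ratio \<sigma> x y) \<partial>lborel \<partial>lborel)"
    by (intro nn_integral_cong)
      (subst nn_integral_cmult[symmetric], auto simp: ennreal_mult' mult.assoc mala_q1_def)
  finally show ?thesis .
qed

text \<open>Swapping current state and proposal turns \<open>f(x) q(x,y) exp (log_ratio x y) = f(y) q(y,x)\<close>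
  back into \<open>f(x) q(x,y)\<close> and flips the sign of the log-ratio.\<close>
lemma detailed_balance:
  assumes \<sigma>: "\<sigma> > 0" and [measurable]: "F \<in> borel_measurable borel"
  shows "(\<integral>\<^sup>+w. ennreal (exp (incr \<sigma> w)) * F (- incr \<sigma> w) \<partial>pair) = (\<integral>\<^sup>+w. F (incr \<sigma> w) \<partial>pair)"
proof -
  have "(\<integral>\<^sup>+w. ennreal (exp (incr \<sigma> w)) * F (- incr \<sigma> w) \<partial>pair) =
     (\<integral>\<^sup>+x. \<integral>\<^sup>+y. ennreal (exp (g x) * mala_q1 g \<sigma> x y) *
       (ennreal (exp (log_ratio \<sigma> x y)) * F (- log_ratio \<sigma> x y)) \<partial>lborel \<partial>lborel)"
    using nn_integral_incr_density[OF \<sigma>, of "\<lambda>r. ennreal (exp r) * F (- r)"] by simp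
  also have "\<dots> = (\<integral>\<^sup>+x. \<integral>\<^sup>+y. ennreal (exp (g y) * mala_q1 g \<sigma> y x) * F (log_ratio \<sigma> y x) \<partial>lborel \<partial>lborel)"
  proof -
    have "ennreal (exp (g x) * mala_q1 g \<sigma> x y) * (ennreal (exp (log_ratio \<sigma> x y)) * F (- log_ratio \<sigma> x y))
        = ennreal (exp (g y) * mala_q1 g \<sigma> y x) * F (log_ratio \<sigma> y x)" for x y
      using \<sigma> unfolding q1_log_ratio[of \<sigma> y x, OF less_imp_neq[OF \<sigma>, symmetric]] log_ratio_antisym[of \<sigma> y x]
      by (simp only: ennreal_mult''[OF exp_ge_zero] mult.assoc[symmetric])
    then show ?thesis by simp
  qed
  also have "\<dots> = (\<integral>\<^sup>+y. \<integral>\<^sup>+x. ennreal (exp (g y) * mala_q1 g \<sigma> y x) * F (log_ratio \<sigma> y x) \<partial>lborel \<partial>lborel)"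
    by (rule lborel_pair.Fubini') measurable
  also have "\<dots> = (\<integral>\<^sup>+w. F (incr \<sigma> w) \<partial>pair)"
    using nn_integral_incr_density[OF \<sigma>, of F] by simp
  finally show ?thesis .
qed

text \<open>The case F = 1 of \<open>detailed_balance\<close> gives E[e^R] = 1. The cubed negative
  part as F shows that \<open>?P\<close> is integrable with the same mean as \<open>?N\<close>, so
  the two error terms with weight 1/6 combine to 1/3.\<close>

lemma mean_incr:
  assumes \<sigma>: "\<sigma> > 0" and R3: "integrable pair (\<lambda>w. \<bar>incr \<sigma> w\<bar> ^ 3)"
  shows "\<bar>(\<integral>w. incr \<sigma> w \<partial>pair) + (\<integral>w. (incr \<sigma> w)\<^sup>2 \<partial>pair) / 2\<bar> \<le> (\<integral>w. \<bar>incr \<sigma> w\<bar> ^ 3 \<partial>pair) / 3"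
proof -
  have m: "incr \<sigma> \<in> borel_measurable pair" by measurable
  note R1 = TZ.integrable_lower_powers(1)[OF m R3]
  note R2 = TZ.integrable_lower_powers(2)[OF m R3]
  have "(\<integral>\<^sup>+w. ennreal (exp (incr \<sigma> w)) \<partial>pair) = 1"
    using detailed_balance[OF \<sigma>, of "\<lambda>_. 1"] by (simp add: TZ.emeasure_space_1)
  then have exp_int: "integrable pair (\<lambda>w. exp (incr \<sigma> w))" "(\<integral>w. exp (incr \<sigma> w) \<partial>pair) = 1"
    by (auto intro: integrableI_nonneg simp: integral_eq_nn_integral)
  let ?N = "\<lambda>w. max 0 (- incr \<sigma> w) ^ 3" and ?P = "\<lambda>w. exp (incr \<sigma> w) * max 0 (incr \<sigma> w) ^ 3"
  have N_le: "?N w \<le> \<bar>incr \<sigma> w\<bar> ^ 3" for w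
    by (intro power_mono) auto
  have N_int: "integrable pair ?N"
    using N_le by (intro Bochner_Integration.integrable_bound[OF R3]) auto
  have "(\<integral>\<^sup>+w. ennreal (?P w) \<partial>pair) = (\<integral>\<^sup>+w. ennreal (?N w) \<partial>pair)"
    using detailed_balance[OF \<sigma>, of "\<lambda>r. ennreal (max 0 (- r) ^ 3)"]
    by (simp add: ennreal_mult')
  also have "\<dots> = ennreal (\<integral>w. ?N w \<partial>pair)"
    by (intro nn_integral_eq_integral N_int) auto
  finally have P: "(\<integral>\<^sup>+w. ennreal (?P w) \<partial>pair) = ennreal (\<integral>w. ?N w \<partial>pair)" .
  then have P_int: "integrable pair ?P" and P_eq: "(\<integral>w. ?P w \<partial>pair) = (\<integral>w. ?N w \<partial>pair)"
    by (auto intro!: integrableI_nonneg simp: integral_eq_nn_integral)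
  have "norm (\<integral>w. exp (incr \<sigma> w) - 1 - incr \<sigma> w - (incr \<sigma> w)\<^sup>2 / 2 \<partial>pair) \<le> (\<integral>w. (?N w + ?P w) / 6 \<partial>pair)"
    using exp_int(1) R1 R2 N_int P_int exp_Taylor2_error
    by (intro Bochner_Integration.integral_norm_bound_integral) auto
  also have "\<dots> = (\<integral>w. ?N w \<partial>pair) / 3"
    using N_int P_int by (simp add: P_eq)
  also have "\<dots> \<le> (\<integral>w. \<bar>incr \<sigma> w\<bar> ^ 3 \<partial>pair) / 3"
    using N_le N_int R3 by (intro divide_right_mono integral_mono) auto
  finally have *: "norm (\<integral>w. exp (incr \<sigma> w) - 1 - incr \<sigma> w - (incr \<sigma> w)\<^sup>2 / 2 \<partial>pair)
    \<le> (\<integral>w. \<bar>incr \<sigma> w\<bar> ^ 3 \<partial>pair) / 3" .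
  have "(\<integral>w. exp (incr \<sigma> w) - 1 - incr \<sigma> w - (incr \<sigma> w)\<^sup>2 / 2 \<partial>pair) =
    - ((\<integral>w. incr \<sigma> w \<partial>pair) + (\<integral>w. (incr \<sigma> w)\<^sup>2 \<partial>pair) / 2)"
    using exp_int R1 R2 by (simp add: TZ.prob_space)
  with * show ?thesis by (simp only: real_norm_def abs_minus_cancel)
qed

subsection \<open>Expansion in the step size\<close>

text \<open>Here h = (y - x) / \<sigma>. Expanding g to third order and g' to second order, the
  contributions g' (y - x) and g'' (y - x)^2 / 2 agree in g y - g x and in the trapezoidal term, so
  only cubic remainders survive. The squared drift already carries \<open>\<sigma>\<^sup>2\<close>
  and needs just the mean value theorem.\<close>

lemma incr_expansion:
  fixes \<sigma> x z :: real
  defines "h \<equiv> z + \<sigma> / 2 * g1 x"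
  shows "\<exists>a b c. \<bar>a - x\<bar> \<le> \<bar>\<sigma> * h\<bar> \<and> \<bar>b - x\<bar> \<le> \<bar>\<sigma> * h\<bar> \<and> \<bar>c - x\<bar> \<le> \<bar>\<sigma> * h\<bar> \<and>
    incr \<sigma> (x, z) = \<sigma> ^ 3 * (h ^ 3 * (g3 a / 6 - g3 b / 4) - h * (g1 c * g2 c) / 4)"
proof -
  let ?y = "step \<sigma> x z"
  have y: "?y - x = \<sigma> * h"
    unfolding step_def h_def by (simp add: power2_eq_square algebra_simps)
  let ?G = "\<lambda>m::nat. if m = 0 then g else if m = 1 then g1 else if m = 2 then g2 else g3"
  have "(?G m has_real_derivative ?G (Suc m) t) (at t)" if "m < 3" for m t
    using that deriv_g[of t] deriv_g1[of t] deriv_g2[of t] by (cases "m = 0"; cases "m = 1"; cases "m = 2") auto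
  then obtain a where a: "\<bar>a - x\<bar> \<le> \<bar>?y - x\<bar>"
    "g ?y = g x + g1 x * (?y - x) + g2 x / 2 * (?y - x)\<^sup>2 + g3 a / 6 * (?y - x) ^ 3"
    using Taylor_between[of 3 ?G x ?y] by (auto simp: numeral_3_eq_3 fact_numeral power2_eq_square)
  let ?G1 = "\<lambda>m::nat. if m = 0 then g1 else if m = 1 then g2 else g3"
  have "(?G1 m has_real_derivative ?G1 (Suc m) t) (at t)" if "m < 2" for m t
    using that deriv_g1[of t] deriv_g2[of t] by (cases "m = 0"; cases "m = 1") auto
  then obtain b where b: "\<bar>b - x\<bar> \<le> \<bar>?y - x\<bar>" "g1 ?y = g1 x + g2 x * (?y - x) + g3 b / 2 * (?y - x)\<^sup>2"
    using Taylor_between[of 2 ?G1 x ?y] by (auto simp: fact_numeral numeral_2_eq_2)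
  let ?S = "\<lambda>m::nat. if m = 0 then (\<lambda>x. (g1 x)\<^sup>2) else (\<lambda>x. 2 * g1 x * g2 x)"
  have "((\<lambda>x. (g1 x)\<^sup>2) has_real_derivative 2 * g1 t * g2 t) (at t)" for t
    by (auto intro!: derivative_eq_intros deriv_g1)
  then obtain c where c: "\<bar>c - x\<bar> \<le> \<bar>?y - x\<bar>" "(g1 ?y)\<^sup>2 = (g1 x)\<^sup>2 + 2 * g1 c * g2 c * (?y - x)"
    using Taylor_between[of 1 ?S x ?y] by auto
  have "incr \<sigma> (x, z) = g ?y - g x - (?y - x) * (g1 x + g1 ?y) / 2 - \<sigma>\<^sup>2 / 8 * ((g1 ?y)\<^sup>2 - (g1 x)\<^sup>2)"
    unfolding incr_def log_ratio_def by simp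
  also have "\<dots> = \<sigma> ^ 3 * (h ^ 3 * (g3 a / 6 - g3 b / 4) - h * (g1 c * g2 c) / 4)"
    \<comment> \<open>The order matters: \<open>c(2)\<close> must rewrite the square of
      \<open>g1 ?y\<close> before \<open>b(2)\<close> replaces \<open>g1 ?y\<close> itself.\<close>
    unfolding a(2) c(2) unfolding b(2) y by (simp add: field_simps power2_eq_square power3_eq_cube)
  finally show ?thesis
    using a(1) b(1) c(1) unfolding y by blast
qed

text \<open>The bound is uniform in the step size up to the factor \<open>\<sigma> ^ 3\<close>, so
  one function serves both for dominated convergence and for the third moment. It is polynomial
  because the intermediate points stay within a polynomial distance of x when \<sigma> \<le>
  1.\<close>

lemma incr_dominated:
  "\<exists>B n k. \<forall>\<sigma> x z. 0 < \<sigma> \<longrightarrow> \<sigma> \<le> 1 \<longrightarrow>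
    \<bar>incr \<sigma> (x, z)\<bar> \<le> \<sigma> ^ 3 * (B * ((1 + \<bar>x\<bar>) ^ n * (1 + \<bar>z\<bar>) ^ k))"
proof -
  obtain C' N where growth': "\<And>x. \<bar>g1 x\<bar> \<le> C' * (1 + \<bar>x\<bar>) ^ N \<and> \<bar>g2 x\<bar> \<le> C' * (1 + \<bar>x\<bar>) ^ N
      \<and> \<bar>g3 x\<bar> \<le> C' * (1 + \<bar>x\<bar>) ^ N"
    using growth by blast
  define C where "C = max 1 C'"
  have C1: "C \<ge> 1" unfolding C_def by simp
  have "C' * (1 + \<bar>x\<bar>) ^ N \<le> C * (1 + \<bar>x\<bar>) ^ N" for x :: real
    unfolding C_def by (intro mult_right_mono) auto
  then have bnd: "\<bar>g1 x\<bar> \<le> C * (1 + \<bar>x\<bar>) ^ N" "\<bar>g2 x\<bar> \<le> C * (1 + \<bar>x\<bar>) ^ N" "\<bar>g3 x\<bar> \<le> C * (1 + \<bar>x\<bar>) ^ N" for x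
    using growth'[of x] order_trans by blast+
  have main: "\<bar>incr \<sigma> (x, z)\<bar> \<le> \<sigma> ^ 3 * (C\<^sup>2 * (3 * C) ^ (2 * N + 3) *
      ((1 + \<bar>x\<bar>) ^ ((N + 1) * (2 * N + 3)) * (1 + \<bar>z\<bar>) ^ (2 * N + 3)))"
    if \<sigma>: "0 < \<sigma>" "\<sigma> \<le> 1" for \<sigma> x z :: real
  proof -
    define h where "h = z + \<sigma> / 2 * g1 x"
    obtain a b c where abc: "\<bar>a - x\<bar> \<le> \<bar>\<sigma> * h\<bar>" "\<bar>b - x\<bar> \<le> \<bar>\<sigma> * h\<bar>" "\<bar>c - x\<bar> \<le> \<bar>\<sigma> * h\<bar>"
      and incr: "incr \<sigma> (x, z) = \<sigma> ^ 3 * (h ^ 3 * (g3 a / 6 - g3 b / 4) - h * (g1 c * g2 c) / 4)"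
      using incr_expansion[of x \<sigma> z] unfolding h_def by blast
    define X Y where "X = 1 + \<bar>x\<bar>" and "Y = 1 + \<bar>z\<bar>"
    have XY: "X \<ge> 1" "Y \<ge> 1" unfolding X_def Y_def by auto
    \<comment> \<open>A single quantity bounding |h| and 1 + |\<xi>| for every intermediate point
      \<xi>. Each of X, Y and C X^N is at most C X^(N+1) Y, whence the factor 3; the exponent N + 1
      covers X even when N = 0. The powers D^(N+3) and D^(2N+1) arising below are then both absorbed
      into D^(2N+3).\<close>
    define D where "D = 3 * C * (X ^ (N + 1) * Y)"
    have XN: "X ^ N \<le> X ^ (N + 1)" "X \<le> X ^ (N + 1)" "1 \<le> X ^ (N + 1)"
      using XY power_increasing[of 1 "N + 1" X] power_increasing[of N "N + 1" X] one_le_power[of X "N + 1"] by auto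
    have prod: "s \<le> C * (X ^ (N + 1) * Y)" if "s \<le> X ^ (N + 1) \<or> s \<le> Y \<or> s \<le> C * X ^ N" for s
    proof -
      have "X ^ (N + 1) * 1 \<le> X ^ (N + 1) * Y" "1 * Y \<le> X ^ (N + 1) * Y"
        using XY XN by (intro mult_left_mono mult_right_mono; simp)+
      moreover have "1 * (X ^ (N + 1) * Y) \<le> C * (X ^ (N + 1) * Y)"
        using XY C1 by (intro mult_right_mono) auto
      moreover have "C * X ^ N \<le> C * (X ^ (N + 1) * Y)"
        using XN C1 calculation(1) by (intro mult_left_mono) auto
      ultimately show ?thesis using that by linarith
    qed
    have "\<bar>\<sigma> / 2 * g1 x\<bar> \<le> 1 * \<bar>g1 x\<bar>"
      using \<sigma> unfolding abs_mult by (intro mult_right_mono) auto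
    then have h: "\<bar>h\<bar> \<le> \<bar>z\<bar> + C * X ^ N"
      using bnd(1)[of x] unfolding h_def X_def by linarith
    have "\<bar>\<sigma> * h\<bar> \<le> 1 * \<bar>h\<bar>"
      using \<sigma> unfolding abs_mult by (intro mult_right_mono) auto
    then have \<sigma>h: "\<bar>\<sigma> * h\<bar> \<le> \<bar>z\<bar> + C * X ^ N" using h by simp
    have D1: "D \<ge> 1"
      using prod[of 1] XN unfolding D_def by simp
    have hD: "\<bar>h\<bar> \<le> D"
      using h prod[of Y] prod[of "C * X ^ N"] prod[of 1] XN unfolding D_def Y_def by simp
    have G: "C * (1 + \<bar>\<xi>\<bar>) ^ N \<le> C * D ^ N" if "\<bar>\<xi> - x\<bar> \<le> \<bar>\<sigma> * h\<bar>" for \<xi>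
    proof -
      have "1 + \<bar>\<xi>\<bar> \<le> X + Y + C * X ^ N"
        using that \<sigma>h unfolding X_def Y_def by linarith
      also have "\<dots> \<le> D"
        using prod[of X] prod[of Y] prod[of "C * X ^ N"] XN unfolding D_def by simp
      finally show ?thesis
        using C1 by (intro mult_left_mono power_mono) auto
    qed
    have a: "\<bar>g3 a\<bar> \<le> C * D ^ N" and b: "\<bar>g3 b\<bar> \<le> C * D ^ N"
      and c: "\<bar>g1 c\<bar> \<le> C * D ^ N" "\<bar>g2 c\<bar> \<le> C * D ^ N"
      using bnd[of a] bnd[of b] bnd[of c] G[OF abc(1)] G[OF abc(2)] G[OF abc(3)] by linarith+
    have CD: "0 \<le> C * D ^ N" "0 \<le> D" using C1 D1 by auto
    have "\<bar>h ^ 3 * (g3 a / 6 - g3 b / 4) - h * (g1 c * g2 c) / 4\<bar>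
        \<le> \<bar>h\<bar> ^ 3 * \<bar>g3 a / 6 - g3 b / 4\<bar> + \<bar>h\<bar> * (\<bar>g1 c\<bar> * \<bar>g2 c\<bar>) / 4"
      using abs_triangle_ineq4[of "h ^ 3 * (g3 a / 6 - g3 b / 4)" "h * (g1 c * g2 c) / 4"]
      by (simp add: abs_mult power_abs)
    also have "\<dots> \<le> D ^ 3 * (C * D ^ N / 2) + D * ((C * D ^ N) * (C * D ^ N)) / 4"
    proof (intro add_mono divide_right_mono mult_mono power_mono)
      show "\<bar>g3 a / 6 - g3 b / 4\<bar> \<le> C * D ^ N / 2" using a b by linarith
    qed (use hD CD c in auto)
    also have "\<dots> \<le> C\<^sup>2 * D ^ (2 * N + 3) / 2 + C\<^sup>2 * D ^ (2 * N + 3) / 4"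
    proof -
      have "C * D ^ (N + 3) \<le> C\<^sup>2 * D ^ (2 * N + 3)"
        using C1 D1 by (intro mult_mono power_increasing) (auto simp: power2_eq_square)
      moreover have "C\<^sup>2 * D ^ (2 * N + 1) \<le> C\<^sup>2 * D ^ (2 * N + 3)"
        using C1 D1 by (intro mult_left_mono power_increasing) auto
      moreover have "D ^ 3 * (C * D ^ N / 2) = C * D ^ (N + 3) / 2"
        by (simp add: power_add)
      moreover have "D * ((C * D ^ N) * (C * D ^ N)) / 4 = C\<^sup>2 * D ^ (2 * N + 1) / 4"
        by (simp add: power_add mult_2 power2_eq_square)
      ultimately show ?thesis by linarith
    qed
    also have "\<dots> \<le> C\<^sup>2 * D ^ (2 * N + 3)" using D1 by simp
    also have "\<dots> = C\<^sup>2 * (3 * C) ^ (2 * N + 3) * (X ^ ((N + 1) * (2 * N + 3)) * Y ^ (2 * N + 3))"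
      unfolding D_def power_mult power_mult_distrib by simp
    finally show ?thesis
      using \<sigma> unfolding incr abs_mult X_def Y_def by (intro mult_mono) auto
  qed
  show ?thesis
    by (intro exI[of _ "C\<^sup>2 * (3 * C) ^ (2 * N + 3)"] exI[of _ "(N + 1) * (2 * N + 3)"] exI[of _ "2 * N + 3"]
        allI impI) (rule main)
qed

lemma incr_tendsto_lead:
  assumes pos: "\<And>n. 0 < \<sigma> n" and lim: "\<sigma> \<longlonglongrightarrow> 0"
  shows "(\<lambda>n. incr (\<sigma> n) w / \<sigma> n ^ 3) \<longlonglongrightarrow> lead w"
proof -
  obtain x z where w: "w = (x, z)" by (cases w)
  define h where "h n = z + \<sigma> n / 2 * g1 x" for n
  have "\<forall>n. \<exists>a b c. \<bar>a - x\<bar> \<le> \<bar>\<sigma> n * h n\<bar> \<and> \<bar>b - x\<bar> \<le> \<bar>\<sigma> n * h n\<bar> \<and> \<bar>c - x\<bar> \<le> \<bar>\<sigma> n * h n\<bar> \<and>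
      incr (\<sigma> n) (x, z) = \<sigma> n ^ 3 * (h n ^ 3 * (g3 a / 6 - g3 b / 4) - h n * (g1 c * g2 c) / 4)"
    unfolding h_def using incr_expansion[of x] by blast
  then obtain a b c where abc: "\<And>n. \<bar>a n - x\<bar> \<le> \<bar>\<sigma> n * h n\<bar>" "\<And>n. \<bar>b n - x\<bar> \<le> \<bar>\<sigma> n * h n\<bar>"
      "\<And>n. \<bar>c n - x\<bar> \<le> \<bar>\<sigma> n * h n\<bar>"
    and incr: "\<And>n. incr (\<sigma> n) (x, z) = \<sigma> n ^ 3 *
      (h n ^ 3 * (g3 (a n) / 6 - g3 (b n) / 4) - h n * (g1 (c n) * g2 (c n)) / 4)"
    unfolding choice_iff by blast
  have "(\<lambda>n. z + \<sigma> n / 2 * g1 x) \<longlonglongrightarrow> z + 0 / 2 * g1 x"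
    by (intro tendsto_intros lim) simp
  then have h: "h \<longlonglongrightarrow> z" unfolding h_def by simp
  have "(\<lambda>n. \<bar>\<sigma> n * h n\<bar>) \<longlonglongrightarrow> \<bar>0 * z\<bar>"
    by (intro tendsto_intros lim h)
  then have \<delta>: "(\<lambda>n. \<bar>\<sigma> n * h n\<bar>) \<longlonglongrightarrow> 0" by simp
  have to_x: "\<xi> \<longlonglongrightarrow> x" if "\<And>n. \<bar>\<xi> n - x\<bar> \<le> \<bar>\<sigma> n * h n\<bar>" for \<xi>
  proof -
    have "(\<lambda>n. \<xi> n - x) \<longlonglongrightarrow> 0"
      by (rule Lim_null_comparison[OF _ \<delta>]) (simp add: that)
    then show ?thesis by (rule LIM_zero_cancel)
  qed
  have "isCont g1 x" "isCont g2 x" "isCont g3 x"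
    using cont cont_g3 by (auto simp: continuous_on_eq_continuous_at)
  then have lims: "(\<lambda>n. g3 (a n)) \<longlonglongrightarrow> g3 x" "(\<lambda>n. g3 (b n)) \<longlonglongrightarrow> g3 x"
    "(\<lambda>n. g1 (c n)) \<longlonglongrightarrow> g1 x" "(\<lambda>n. g2 (c n)) \<longlonglongrightarrow> g2 x"
    using to_x[OF abc(1)] to_x[OF abc(2)] to_x[OF abc(3)] isCont_tendsto_compose by blast+
  have "(\<lambda>n. h n ^ 3 * (g3 (a n) / 6 - g3 (b n) / 4) - h n * (g1 (c n) * g2 (c n)) / 4)
      \<longlonglongrightarrow> z ^ 3 * (g3 x / 6 - g3 x / 4) - z * (g1 x * g2 x) / 4"
    by (intro tendsto_intros lims h) auto
  moreover have "z ^ 3 * (g3 x / 6 - g3 x / 4) - z * (g1 x * g2 x) / 4 = lead w"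
    unfolding lead_def w by simp
  moreover have "incr (\<sigma> n) w / \<sigma> n ^ 3 = h n ^ 3 * (g3 (a n) / 6 - g3 (b n) / 4) - h n * (g1 (c n) * g2 (c n)) / 4" for n
    unfolding w incr using pos[of n] by simp
  ultimately show ?thesis by simp
qed

lemma integrable_target_power: "integrable target (\<lambda>x. (1 + \<bar>x\<bar>) ^ n)"
  using moments by (intro integrable_density_one_plus_abs_power) (auto simp: mult.commute)

lemma integrable_noise_power: "integrable noise (\<lambda>x. (1 + \<bar>x\<bar>) ^ n)"
  using integrable_std_normal_moment_abs by (intro integrable_density_one_plus_abs_power) auto

lemma integrable_pair_power: "integrable pair (\<lambda>w. (1 + \<bar>fst w\<bar>) ^ n * (1 + \<bar>snd w\<bar>) ^ k)"
proof (rule TZ.Fubini_integrable)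
  show "integrable target (\<lambda>x. \<integral>z. norm ((1 + \<bar>fst (x, z)\<bar>) ^ n * (1 + \<bar>snd (x, z)\<bar>) ^ k) \<partial>noise)"
    using integrable_target_power[of n] by (simp add: abs_mult)
  show "AE x in target. integrable noise (\<lambda>z. (1 + \<bar>fst (x, z)\<bar>) ^ n * (1 + \<bar>snd (x, z)\<bar>) ^ k)"
    using integrable_noise_power[of k] by simp
qed measurable

lemma incr_moments:
  shows incr_cube: "\<exists>K. \<forall>\<sigma>. 0 < \<sigma> \<longrightarrow> \<sigma> \<le> 1 \<longrightarrow> integrable pair (\<lambda>w. \<bar>incr \<sigma> w\<bar> ^ 3) \<and>
      (\<integral>w. \<bar>incr \<sigma> w\<bar> ^ 3 \<partial>pair) \<le> K * \<sigma> ^ 9" (is ?cube)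
    and integrable_lead: "integrable pair (\<lambda>w. (lead w)\<^sup>2)" (is ?lead)
    and incr_square: "((\<lambda>\<sigma>. (\<integral>w. (incr \<sigma> w)\<^sup>2 \<partial>pair) / \<sigma> ^ 6) \<longlongrightarrow> (\<integral>w. (lead w)\<^sup>2 \<partial>pair))
      (at 0 within {0<..1})" (is ?square)
proof -
  obtain B n k where B: "\<And>\<sigma> x z. 0 < \<sigma> \<Longrightarrow> \<sigma> \<le> 1 \<Longrightarrow>
    \<bar>incr \<sigma> (x, z)\<bar> \<le> \<sigma> ^ 3 * (B * ((1 + \<bar>x\<bar>) ^ n * (1 + \<bar>z\<bar>) ^ k))"
    using incr_dominated by blast
  define P where "P w = B * ((1 + \<bar>fst w\<bar>) ^ n * (1 + \<bar>snd w\<bar>) ^ k)" for w :: "real \<times> real"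
  have P: "\<bar>incr \<sigma> w\<bar> \<le> \<sigma> ^ 3 * P w" if "0 < \<sigma>" "\<sigma> \<le> 1" for \<sigma> w
    using B[OF that, of "fst w" "snd w"] unfolding P_def by simp
  have P_int: "integrable pair (\<lambda>w. P w ^ j)" for j
    using integrable_pair_power[of "n * j" "k * j"]
    unfolding P_def power_mult_distrib power_mult[symmetric] by simp
  \<comment> \<open>\<open>B\<close> comes without a sign; nonnegativity is read off from the
    domination at \<sigma> = 1.\<close>
  have P_pos: "P w \<ge> 0" for w
    using P[of 1 w] by simp
  show ?cube
  proof (intro exI[of _ "\<integral>w. P w ^ 3 \<partial>pair"] allI impI conjI)
    fix \<sigma> :: real assume \<sigma>: "0 < \<sigma>" "\<sigma> \<le> 1"
    have le: "\<bar>incr \<sigma> w\<bar> ^ 3 \<le> P w ^ 3 * \<sigma> ^ 9" for w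
      using power_mono[OF P[OF \<sigma>, of w], of 3]
      by (simp add: power_mult_distrib power_mult[symmetric] mult.commute)
    have "integrable pair (\<lambda>w. P w ^ 3 * \<sigma> ^ 9)"
      using P_int[of 3] by simp
    then show int: "integrable pair (\<lambda>w. \<bar>incr \<sigma> w\<bar> ^ 3)"
      by (rule Bochner_Integration.integrable_bound) (use le \<sigma> in \<open>auto simp: abs_mult P_pos\<close>)
    have "(\<integral>w. \<bar>incr \<sigma> w\<bar> ^ 3 \<partial>pair) \<le> (\<integral>w. P w ^ 3 * \<sigma> ^ 9 \<partial>pair)"
      using le int P_int[of 3] by (intro integral_mono) auto
    then show "(\<integral>w. \<bar>incr \<sigma> w\<bar> ^ 3 \<partial>pair) \<le> (\<integral>w. P w ^ 3 \<partial>pair) * \<sigma> ^ 9"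
      by simp
  qed
  have dom: "integrable pair (\<lambda>w. (lead w)\<^sup>2) \<and>
      (\<lambda>n. \<integral>w. (incr (\<sigma> n) w / \<sigma> n ^ 3)\<^sup>2 \<partial>pair) \<longlonglongrightarrow> (\<integral>w. (lead w)\<^sup>2 \<partial>pair)"
    if \<sigma>: "\<And>n. 0 < \<sigma> n" "\<And>n. \<sigma> n \<le> 1" and lim: "\<sigma> \<longlonglongrightarrow> 0" for \<sigma> :: "nat \<Rightarrow> real"
  proof -
    have bound: "norm ((incr (\<sigma> n) w / \<sigma> n ^ 3)\<^sup>2) \<le> (P w)\<^sup>2" for n w
    proof -
      have "\<bar>incr (\<sigma> n) w / \<sigma> n ^ 3\<bar> \<le> P w"
        using P[OF \<sigma>(1)[of n] \<sigma>(2)[of n], of w] \<sigma>(1)[of n] by (simp add: field_simps)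
      then have "\<bar>incr (\<sigma> n) w / \<sigma> n ^ 3\<bar>\<^sup>2 \<le> (P w)\<^sup>2" by (intro power_mono) auto
      then show ?thesis by (simp only: real_norm_def power_abs power2_abs)
    qed
    have conv: "AE w in pair. (\<lambda>n. (incr (\<sigma> n) w / \<sigma> n ^ 3)\<^sup>2) \<longlonglongrightarrow> (lead w)\<^sup>2"
      using incr_tendsto_lead[OF \<sigma>(1) lim] by (intro AE_I2 tendsto_power) auto
    show ?thesis
      using bound by (intro conjI integrable_dominated_convergence[OF _ _ P_int[of 2] conv]
          integral_dominated_convergence[OF _ _ P_int[of 2] conv]) auto
  qed
  show ?lead
    \<comment> \<open>Any null sequence in (0,1] would do, as the limit function does not depend on
      it.\<close>
    using dom[of "\<lambda>n. 1 / Suc n"] LIMSEQ_inverse_real_of_nat by (auto simp: inverse_eq_divide)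
  have sq: "(\<integral>w. (incr \<sigma> w / \<sigma> ^ 3)\<^sup>2 \<partial>pair) = (\<integral>w. (incr \<sigma> w)\<^sup>2 \<partial>pair) / \<sigma> ^ 6" for \<sigma>
    by (simp add: power_divide power_mult[symmetric])
  show ?square
    unfolding tendsto_at_iff_sequentially
    using dom unfolding sq by (auto simp: o_def)
qed

subsection \<open>The asymptotic variance\<close>

lemma poly_bounded_derivs: "poly_bounded g1" "poly_bounded g2" "poly_bounded g3"
  using growth unfolding poly_bounded_def by blast+

lemma integrable_poly_bounded:
  assumes "poly_bounded p" and [measurable]: "p \<in> borel_measurable borel"
  shows "integrable lborel (\<lambda>x. exp (g x) * p x)"
proof -
  obtain C n where p: "\<And>x. \<bar>p x\<bar> \<le> C * (1 + \<bar>x\<bar>) ^ n"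
    using assms(1) unfolding poly_bounded_def by blast
  have "integrable lborel (\<lambda>x. exp (g x) * (1 + \<bar>x\<bar>) ^ n)"
    using integrable_target_power[of n] by (subst (asm) integrable_density) auto
  then have "integrable lborel (\<lambda>x. C * (exp (g x) * (1 + \<bar>x\<bar>) ^ n))"
    by simp
  then show ?thesis
  proof (rule Bochner_Integration.integrable_bound)
    show "AE x in lborel. norm (exp (g x) * p x) \<le> norm (C * (exp (g x) * (1 + \<bar>x\<bar>) ^ n))"
    proof (rule AE_I2)
      fix x
      have "exp (g x) * \<bar>p x\<bar> \<le> exp (g x) * (C * (1 + \<bar>x\<bar>) ^ n)"
        using p by (intro mult_left_mono) auto
      also have "\<dots> \<le> \<bar>C * (exp (g x) * (1 + \<bar>x\<bar>) ^ n)\<bar>"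
        by (simp add: mult_ac abs_ge_self)
      finally show "norm (exp (g x) * p x) \<le> norm (C * (exp (g x) * (1 + \<bar>x\<bar>) ^ n))"
        by (simp add: abs_mult)
    qed
  qed measurable
qed

text \<open>Integrating out the noise leaves the Gaussian moments 15, 3 and 1 of orders 6, 4 and 2:
  15/144 = 5/48 and 2 * 3/48 = 1/8.\<close>

lemma lead_second_moment:
  "(\<integral>w. (lead w)\<^sup>2 \<partial>pair) =
    (\<integral>x. exp (g x) * (5 * (g3 x)\<^sup>2 / 48 + g1 x * g2 x * g3 x / 8 + (g1 x * g2 x)\<^sup>2 / 16) \<partial>lborel)"
proof -
  have inner: "(\<integral>z. (lead (x, z))\<^sup>2 \<partial>noise) =
      5 * (g3 x)\<^sup>2 / 48 + g1 x * g2 x * g3 x / 8 + (g1 x * g2 x)\<^sup>2 / 16" for x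
  proof -
    let ?A = "g3 x / 12" and ?B = "g1 x * g2 x / 4"
    have "(lead (x, z))\<^sup>2 = ?A\<^sup>2 * z ^ 6 + 2 * ?A * ?B * z ^ 4 + ?B\<^sup>2 * z ^ 2" for z
      unfolding lead_def by (simp add: field_simps power2_eq_square power3_eq_cube eval_nat_numeral)
    then have "(\<integral>z. (lead (x, z))\<^sup>2 \<partial>noise) =
        (\<integral>z. ?A\<^sup>2 * z ^ 6 + 2 * ?A * ?B * z ^ 4 + ?B\<^sup>2 * z ^ 2 \<partial>noise)" by presburger
    also have "\<dots> = (\<integral>z. ?A\<^sup>2 * z ^ 6 \<partial>noise) + (\<integral>z. 2 * ?A * ?B * z ^ 4 \<partial>noise) + (\<integral>z. ?B\<^sup>2 * z ^ 2 \<partial>noise)"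
      by (subst Bochner_Integration.integral_add;
          (intro Bochner_Integration.integrable_add integrable_mult_right integrable_std_normal_distribution_moment)?)+
         simp
    also have "\<dots> = ?A\<^sup>2 * 15 + 2 * ?A * ?B * 3 + ?B\<^sup>2"
      using std_normal_distribution_even_moments(1)[of 3] std_normal_distribution_even_moments(1)[of 2]
        std_normal_distribution_even_moments(1)[of 1]
      by (simp add: fact_numeral)
    also have "\<dots> = 5 * (g3 x)\<^sup>2 / 48 + g1 x * g2 x * g3 x / 8 + (g1 x * g2 x)\<^sup>2 / 16"
      by (simp add: field_simps power2_eq_square)
    finally show ?thesis .
  qed
  have "(\<integral>w. (lead w)\<^sup>2 \<partial>pair) = (\<integral>x. (\<integral>z. (lead (x, z))\<^sup>2 \<partial>noise) \<partial>target)"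
    by (rule TZ.integral_fst'[symmetric, OF integrable_lead])
  also have "\<dots> = (\<integral>x. exp (g x) * (5 * (g3 x)\<^sup>2 / 48 + g1 x * g2 x * g3 x / 8 + (g1 x * g2 x)\<^sup>2 / 16) \<partial>lborel)"
    unfolding inner by (subst integral_density) auto
  finally show ?thesis .
qed

text \<open>The two expressions for the variance differ by \<open>\<integral>(f g' g''\<^sup>2)' / 16 = 0\<close>.\<close>
lemma lead_second_moment_kappa:
  "(\<integral>w. (lead w)\<^sup>2 \<partial>pair) = (\<integral>x. exp (g x) * ((5 * (g3 x)\<^sup>2 - 3 * g2 x ^ 3) / 48) \<partial>lborel)"
proof -
  let ?u = "\<lambda>x. exp (g x) * (g1 x * g2 x * g2 x)"
  let ?u' = "\<lambda>x. exp (g x) * (g1 x * g2 x * (g1 x * g2 x)) + exp (g x) * (g2 x * g2 x * g2 x) +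
    2 * (exp (g x) * (g1 x * g2 x * g3 x))"
  note pb = poly_bounded_mult poly_bounded_derivs
  have ints: "integrable lborel (\<lambda>x. exp (g x) * (g1 x * g2 x * (g1 x * g2 x)))"
    "integrable lborel (\<lambda>x. exp (g x) * (g2 x * g2 x * g2 x))"
    "integrable lborel (\<lambda>x. exp (g x) * (g1 x * g2 x * g3 x))"
    "integrable lborel (\<lambda>x. exp (g x) * (g3 x * g3 x))"
    by (rule integrable_poly_bounded; (intro pb)?; measurable?)+
  have "(\<integral>x. ?u' x \<partial>lborel) = 0"
  proof (rule integral_deriv_eq_0)
    show "(?u has_real_derivative ?u' x) (at x)" for x
      by (auto intro!: derivative_eq_intros deriv_g deriv_g1 deriv_g2 simp: algebra_simps)
    show "continuous_on UNIV ?u'"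
      by (intro continuous_intros cont cont_g3)
    show "integrable lborel ?u"
      by (rule integrable_poly_bounded; (intro pb)?; measurable?)
    show "integrable lborel ?u'"
      using ints by simp
  qed
  then have 0: "(\<integral>x. exp (g x) * (g1 x * g2 x * (g1 x * g2 x)) \<partial>lborel) + (\<integral>x. exp (g x) * (g2 x * g2 x * g2 x) \<partial>lborel)
     + 2 * (\<integral>x. exp (g x) * (g1 x * g2 x * g3 x) \<partial>lborel) = 0"
    using ints by simp
  have "(\<integral>w. (lead w)\<^sup>2 \<partial>pair) = (\<integral>x. 5 / 48 * (exp (g x) * (g3 x * g3 x)) +
      1 / 8 * (exp (g x) * (g1 x * g2 x * g3 x)) + 1 / 16 * (exp (g x) * (g1 x * g2 x * (g1 x * g2 x))) \<partial>lborel)"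
    unfolding lead_second_moment by (simp add: algebra_simps power2_eq_square)
  also have "\<dots> = 5 / 48 * (\<integral>x. exp (g x) * (g3 x * g3 x) \<partial>lborel) + 1 / 8 * (\<integral>x. exp (g x) * (g1 x * g2 x * g3 x) \<partial>lborel)
      + 1 / 16 * (\<integral>x. exp (g x) * (g1 x * g2 x * (g1 x * g2 x)) \<partial>lborel)"
    using ints by simp
  \<comment> \<open>One sixteenth of \<open>0\<close> exchanges both mixed terms for -1/16 of the
    integral of f g''^3, the summand -3/48 of the stated constant.\<close>
  also have "\<dots> = 5 / 48 * (\<integral>x. exp (g x) * (g3 x * g3 x) \<partial>lborel) - 1 / 16 * (\<integral>x. exp (g x) * (g2 x * g2 x * g2 x) \<partial>lborel)"
    using 0 by simp
  also have "\<dots> = (\<integral>x. 5 / 48 * (exp (g x) * (g3 x * g3 x)) - 1 / 16 * (exp (g x) * (g2 x * g2 x * g2 x)) \<partial>lborel)"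
    using ints by simp
  also have "\<dots> = (\<integral>x. exp (g x) * ((5 * (g3 x)\<^sup>2 - 3 * g2 x ^ 3) / 48) \<partial>lborel)"
    by (intro Bochner_Integration.integral_cong) (simp_all add: field_simps power2_eq_square power3_eq_cube)
  finally show ?thesis .
qed

text \<open>An exponential function is no density: translating by 1 would force \<open>e\<^sup>\<beta> = 1\<close> and shift the mean
  by 1 at the same time.\<close>
lemma not_affine: "\<not> (\<forall>x. g1 x = \<beta>)"
proof
  assume "\<forall>x. g1 x = \<beta>"
  then have "((\<lambda>x. g x - \<beta> * x) has_real_derivative 0) (at x)" for x
    using deriv_g[of x] by (auto intro!: derivative_eq_intros)
  then obtain \<alpha> where "\<And>x. g x - \<beta> * x = \<alpha>"
    using DERIV_isconst_all by meson
  then have g: "g x = \<alpha> + \<beta> * x" for x by (simp add: algebra_simps)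
  then have shift: "exp (g (1 + 1 * x)) = exp \<beta> * exp (g x)" for x
    by (simp add: exp_add[symmetric] algebra_simps)
  have "(\<integral>x. exp (g x) \<partial>lborel) = exp \<beta> * (\<integral>x. exp (g x) \<partial>lborel)"
    using lborel_integral_real_affine[of 1 "\<lambda>x. exp (g x)" 1] unfolding shift by simp
  then have \<beta>: "exp \<beta> = 1" by (simp add: total_mass)
  have int: "integrable lborel (\<lambda>x. x * exp (g x))"
    using moments[of 1] by (rule Bochner_Integration.integrable_bound) (auto simp: abs_mult)
  have "(\<integral>x. x * exp (g x) \<partial>lborel) = (\<integral>x. exp (g x) + x * exp (g x) \<partial>lborel)"
    using lborel_integral_real_affine[of 1 "\<lambda>x. x * exp (g x)" 1] unfolding shift \<beta>
    by (simp add: distrib_right)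
  also have "\<dots> = 1 + (\<integral>x. x * exp (g x) \<partial>lborel)"
    using int moments[of 0] by (simp add: total_mass)
  finally show False by simp
qed

text \<open>The form before integration by parts is used because its integrand is a sum of squares,
  whereas 5 g'''^2 - 3 g''^3 may change sign. If the integral vanished, then g''' = 0 and g' g'' = 0
  everywhere. So g'' is constant; if it is 0 then g' is constant, otherwise g' = 0, and both are
  excluded by \<open>not_affine\<close>.\<close>

lemma lead_second_moment_pos: "(\<integral>w. (lead w)\<^sup>2 \<partial>pair) > 0"
proof -
  let ?p = "\<lambda>x. exp (g x) * (5 * (g3 x)\<^sup>2 / 48 + g1 x * g2 x * g3 x / 8 + (g1 x * g2 x)\<^sup>2 / 16)"
  have sos: "5 * (g3 x)\<^sup>2 / 48 + g1 x * g2 x * g3 x / 8 + (g1 x * g2 x)\<^sup>2 / 16 =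
      (g3 x + g1 x * g2 x)\<^sup>2 / 16 + (g3 x)\<^sup>2 / 24" for x
    by (simp add: power2_eq_square field_simps)
  have nonneg: "?p x \<ge> 0" for x unfolding sos by simp
  have int: "integrable lborel ?p"
  proof -
    note pb = poly_bounded_mult poly_bounded_derivs
    have ints: "integrable lborel (\<lambda>x. exp (g x) * (g1 x * g2 x * (g1 x * g2 x)))"
      "integrable lborel (\<lambda>x. exp (g x) * (g1 x * g2 x * g3 x))"
      "integrable lborel (\<lambda>x. exp (g x) * (g3 x * g3 x))"
      by (rule integrable_poly_bounded; (intro pb)?; measurable?)+
    have "?p = (\<lambda>x. 5 / 48 * (exp (g x) * (g3 x * g3 x)) +
      1 / 8 * (exp (g x) * (g1 x * g2 x * g3 x)) + 1 / 16 * (exp (g x) * (g1 x * g2 x * (g1 x * g2 x))))"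
      by (simp add: algebra_simps power2_eq_square)
    then show ?thesis using ints by simp
  qed
  have "(\<integral>x. ?p x \<partial>lborel) \<noteq> 0"
  proof
    assume "(\<integral>x. ?p x \<partial>lborel) = 0"
    then have "AE x in lborel. ?p x = 0"
      using integral_nonneg_eq_0_iff_AE[OF int] nonneg by simp
    then have "?p x = 0" for x
      by (intro AE_lborel_continuous_zero[of ?p]) (intro continuous_intros cont cont_g3, auto)
    then have "(g3 x + g1 x * g2 x)\<^sup>2 / 16 + (g3 x)\<^sup>2 / 24 = 0" for x
      unfolding sos by simp
    then have z: "g3 x = 0" "g1 x * g2 x = 0" for x
      using add_nonneg_eq_0_iff[of "(g3 x + g1 x * g2 x)\<^sup>2 / 16" "(g3 x)\<^sup>2 / 24"] by auto
    have "g2 x = g2 0" for x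
      using DERIV_isconst_all[of g2] deriv_g2 z(1) by metis
    show False
    proof (cases "g2 0 = 0")
      case True
      then have "g2 x = 0" for x using \<open>\<And>x. g2 x = g2 0\<close> by metis
      then have "g1 x = g1 0" for x
        using DERIV_isconst_all[of g1] deriv_g1 by metis
      then show False using not_affine by blast
    next
      case False
      then have "g1 x = 0" for x using z(2)[of x] \<open>g2 x = g2 0\<close> by simp
      then show False using not_affine by blast
    qed
  qed
  moreover have "(\<integral>x. ?p x \<partial>lborel) \<ge> 0"
    using nonneg by (intro integral_nonneg_AE) auto
  ultimately show ?thesis unfolding lead_second_moment by linarith
qed

subsection \<open>The law of the log acceptance ratio\<close>

abbreviation joint :: "nat \<Rightarrow> ((nat \<Rightarrow> real) \<times> (nat \<Rightarrow> real)) measure" where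
  "joint d \<equiv> PiM {..<d} (\<lambda>_. target) \<Otimes>\<^sub>M PiM {..<d} (\<lambda>_. noise)"

definition total :: "real \<Rightarrow> nat set \<Rightarrow> (nat \<Rightarrow> real) \<times> (nat \<Rightarrow> real) \<Rightarrow> real" where
  "total \<sigma> A w = (\<Sum>i\<in>A. incr \<sigma> (fst w i, snd w i))"

definition law :: "nat \<Rightarrow> real \<Rightarrow> nat set \<Rightarrow> real measure" where
  "law d \<sigma> A = distr (joint d) borel (total \<sigma> A)"

lemma prob_space_joint: "prob_space (joint d)"
proof -
  interpret PM: product_prob_space "\<lambda>_. target" "{..<d}" ..
  interpret PN: product_prob_space "\<lambda>_. noise" "{..<d}" ..
  interpret P: pair_prob_space "PiM {..<d} (\<lambda>_. target)" "PiM {..<d} (\<lambda>_. noise)" ..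
  show ?thesis by (rule P.prob_space_axioms)
qed

lemma measurable_total:
  assumes "A \<subseteq> {..<d}"
  shows "total \<sigma> A \<in> borel_measurable (joint d)"
proof -
  have "(\<lambda>w. incr \<sigma> (fst w i, snd w i)) \<in> borel_measurable (joint d)" if "i \<in> A" for i
  proof -
    have "(\<lambda>w. (fst w i, snd w i)) \<in> measurable (joint d) pair"
      using that assms
      by (intro measurable_Pair measurable_compose[OF measurable_fst measurable_component_singleton]
          measurable_compose[OF measurable_snd measurable_component_singleton]) auto
    then show ?thesis by (rule measurable_compose) measurable
  qed
  then show ?thesis unfolding total_def by (intro borel_measurable_sum)
qed

lemma real_distribution_law: "A \<subseteq> {..<d} \<Longrightarrow> real_distribution (law d \<sigma> A)"
  unfolding law_def
  by (intro prob_space.real_distribution_distr prob_space_joint measurable_total)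

text \<open>Coordinates outside \<open>A\<close> contribute the factor 1, which lets the product run
  over the full index set of the joint measure. The result sees \<open>A\<close> only through its
  cardinality.\<close>

lemma char_law:
  assumes A: "A \<subseteq> {..<d}"
  shows "char (law d \<sigma> A) t = (CLINT w|pair. iexp (t * incr \<sigma> w)) ^ card A"
proof -
  let ?h = "\<lambda>i w. if i \<in> A then iexp (t * incr \<sigma> w) else 1"
  have fin: "finite A" using A finite_subset by blast
  have "iexp (t * total \<sigma> A w) = (\<Prod>i\<in>{..<d}. ?h i (fst w i, snd w i))" for w
  proof -
    have "iexp (t * total \<sigma> A w) = (\<Prod>i\<in>A. iexp (t * incr \<sigma> (fst w i, snd w i)))"
      unfolding total_def by (simp add: sum_distrib_left exp_sum[OF fin])
    also have "\<dots> = (\<Prod>i\<in>{..<d}. ?h i (fst w i, snd w i))"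
      using A by (simp add: prod.If_cases Int_absorb1)
    finally show ?thesis .
  qed
  then have "char (law d \<sigma> A) t = (CLINT w|joint d. \<Prod>i\<in>{..<d}. ?h i (fst w i, snd w i))"
    unfolding char_def law_def by (subst integral_distr[OF measurable_total[OF A]]) simp_all
  also have "\<dots> = (\<Prod>i\<in>{..<d}. CLINT w|pair. ?h i w)"
    by (rule integral_prod_pair_PiM[OF prob_space_target prob_space_noise]) auto
  also have "\<dots> = (\<Prod>i\<in>{..<d}. if i \<in> A then CLINT w|pair. iexp (t * incr \<sigma> w) else 1)"
    by (intro prod.cong) (auto simp: TZ.prob_space)
  also have "\<dots> = (CLINT w|pair. iexp (t * incr \<sigma> w)) ^ card A"
    using A by (simp add: prod.If_cases Int_absorb1)
  finally show ?thesis .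
qed

section \<open>From the acceptance rate to the law of one sum\<close>

lemma mala_ratio_eq_exp_total:
  assumes A: "A \<subseteq> {..<d}" and \<sigma>: "\<sigma> > 0"
  shows "mala_ratio g d \<sigma> A x (mala_prop g \<sigma> A x z) = exp (total \<sigma> A (x, z))"
proof -
  let ?y = "mala_prop g \<sigma> A x z"
  have fin: "finite A" using A finite_subset by blast
  have y_in: "?y i = step \<sigma> (x i) (z i)" if "i \<in> A" for i
    using that unfolding mala_prop_def step_def deriv_g_eq by simp
  have y_out: "?y i = x i" if "i \<notin> A" for i
    using that unfolding mala_prop_def by simp
  \<comment> \<open>Frozen coordinates have the same density factor in numerator and denominator and
    cancel; on \<open>A\<close> the identity \<open>q1_log_ratio\<close> applies
    coordinatewise.\<close>
  have split: "(\<Prod>i<d. exp (g (w i))) = (\<Prod>i\<in>{..<d} - A. exp (g (w i))) * (\<Prod>i\<in>A. exp (g (w i)))" for w :: "nat \<Rightarrow> real"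
    using A by (intro prod.subset_diff) auto
  have out: "(\<Prod>i\<in>{..<d} - A. exp (g (?y i))) = (\<Prod>i\<in>{..<d} - A. exp (g (x i)))"
    by (intro prod.cong) (auto simp: y_out)
  have "(\<Prod>i\<in>A. exp (g (?y i))) * (\<Prod>i\<in>A. mala_q1 g \<sigma> (?y i) (x i)) =
      (\<Prod>i\<in>A. exp (g (x i)) * mala_q1 g \<sigma> (x i) (?y i) * exp (log_ratio \<sigma> (x i) (?y i)))"
    using \<sigma> unfolding prod.distrib[symmetric] by (intro prod.cong refl q1_log_ratio) auto
  also have "\<dots> = (\<Prod>i\<in>A. exp (g (x i))) * (\<Prod>i\<in>A. mala_q1 g \<sigma> (x i) (?y i)) * exp (total \<sigma> A (x, z))"
    unfolding total_def incr_def by (simp add: prod.distrib exp_sum[OF fin] y_in cong: prod.cong)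
  finally have inA: "(\<Prod>i\<in>A. exp (g (?y i))) * (\<Prod>i\<in>A. mala_q1 g \<sigma> (?y i) (x i)) =
     (\<Prod>i\<in>A. exp (g (x i))) * (\<Prod>i\<in>A. mala_q1 g \<sigma> (x i) (?y i)) * exp (total \<sigma> A (x, z))" .
  have nz: "(\<Prod>i\<in>A. mala_q1 g \<sigma> (x i) (?y i)) \<noteq> 0" "(\<Prod>i<d. exp (g (x i))) \<noteq> 0"
    using \<sigma> fin normal_density_pos[of \<sigma>] unfolding mala_q1_def
    by (auto simp: less_imp_neq[symmetric])
  have "(\<Prod>i<d. exp (g (?y i))) * (\<Prod>i\<in>A. mala_q1 g \<sigma> (?y i) (x i)) =
      (\<Prod>i\<in>{..<d} - A. exp (g (x i))) * ((\<Prod>i\<in>A. exp (g (?y i))) * (\<Prod>i\<in>A. mala_q1 g \<sigma> (?y i) (x i)))"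
    unfolding split[of ?y] out by (simp only: mult.assoc)
  also have "\<dots> = (\<Prod>i<d. exp (g (x i))) * (\<Prod>i\<in>A. mala_q1 g \<sigma> (x i) (?y i)) * exp (total \<sigma> A (x, z))"
    unfolding inA split[of x] by (simp only: mult.assoc)
  finally show ?thesis
    unfolding mala_ratio_def using nz by simp
qed

text \<open>All m-subsets give the same characteristic function, hence the same law, so the average
  over subsets has equal terms and the set \<open>{..<m}\<close> may represent them. The condition m
  \<le> d makes the number of subsets nonzero.\<close>

lemma mala_accept_eq_law:
  assumes m: "m \<le> d" and \<sigma>: "\<sigma> > 0"
  shows "mala_accept g d m \<sigma> = (\<integral>r. min 1 (exp r) \<partial>law d \<sigma> {..<m})"
proof -
  let ?S = "{A. A \<subseteq> {..<d} \<and> card A = m}"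
  have "(\<integral>(x, z). min 1 (mala_ratio g d \<sigma> A x (mala_prop g \<sigma> A x z)) \<partial>joint d) =
      (\<integral>r. min 1 (exp r) \<partial>law d \<sigma> {..<m})" if A: "A \<in> ?S" for A
  proof -
    have sub: "A \<subseteq> {..<d}" "{..<m} \<subseteq> {..<d}" using A m by auto
    have "(\<integral>(x, z). min 1 (mala_ratio g d \<sigma> A x (mala_prop g \<sigma> A x z)) \<partial>joint d) =
        (\<integral>w. min 1 (exp (total \<sigma> A w)) \<partial>joint d)"
      by (intro Bochner_Integration.integral_cong) (auto simp: mala_ratio_eq_exp_total[OF sub(1) \<sigma>])
    also have "\<dots> = (\<integral>r. min 1 (exp r) \<partial>law d \<sigma> A)"
      unfolding law_def by (subst integral_distr[OF measurable_total[OF sub(1)]]) auto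
    also have "law d \<sigma> A = law d \<sigma> {..<m}"
      using A by (intro Levy_uniqueness real_distribution_law sub) (use A m in \<open>auto simp: char_law fun_eq_iff\<close>)
    finally show ?thesis .
  qed
  then have "mala_accept g d m \<sigma> = (\<Sum>A\<in>?S. \<integral>r. min 1 (exp r) \<partial>law d \<sigma> {..<m}) / card ?S"
    unfolding mala_accept_def Let_def by (intro arg_cong2[where f = "(/)"] sum.cong) auto
  moreover have "card ?S = d choose m"
    by (simp add: n_subsets)
  ultimately show ?thesis
    using m by (simp only: sum_constant) simp
qed

theorem acceptance_rate_limit:
  fixes m :: "nat \<Rightarrow> nat" and c l :: real
  assumes l: "l > 0" and c: "c > 0" and m: "\<And>d. m d \<le> d" and m_lim: "(\<lambda>d. m d / d) \<longlonglongrightarrow> c"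
  shows "(\<lambda>d. mala_accept g d (m d) (l * real d powr (-1/6))) \<longlonglongrightarrow>
    2 * Phi (- (sqrt c * sqrt (\<integral>w. (lead w)\<^sup>2 \<partial>pair) * l ^ 3 / 2))"
proof -
  define \<sigma> where "\<sigma> d = l * real d powr (-1/6)" for d
  define \<kappa>2 where "\<kappa>2 = (\<integral>w. (lead w)\<^sup>2 \<partial>pair)"
  define s where "s = sqrt c * sqrt \<kappa>2 * l ^ 3"
  define v where "v d = (\<integral>w. (incr (\<sigma> d) w)\<^sup>2 \<partial>pair)" for d
  have \<kappa>2: "\<kappa>2 > 0" unfolding \<kappa>2_def by (rule lead_second_moment_pos)
  have s: "s > 0" unfolding s_def using c \<kappa>2 l by simp
  have s2: "s\<^sup>2 = c * l ^ 6 * \<kappa>2"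
    unfolding s_def using c \<kappa>2 by (simp add: power_mult_distrib power_mult[symmetric])
  have \<sigma>_pos: "\<sigma> d > 0" if "d \<ge> 1" for d
    using that l unfolding \<sigma>_def by simp
  have \<sigma>6: "\<sigma> d ^ 6 = l ^ 6 / d" if "d \<ge> 1" for d
  proof -
    have "(real d powr (-1/6)) ^ 6 = real d powr (real 6 * (-1/6))"
      using that by (intro powr_power) auto
    also have "\<dots> = 1 / d" using that by (simp add: powr_minus_divide)
    finally show ?thesis unfolding \<sigma>_def power_mult_distrib by simp
  qed
  have \<sigma>_lim: "\<sigma> \<longlonglongrightarrow> 0"
  proof -
    have "(\<lambda>d. l * real d powr (-1/6)) \<longlonglongrightarrow> l * 0"
      by (intro tendsto_intros tendsto_neg_powr filterlim_real_sequentially) auto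
    then show ?thesis unfolding \<sigma>_def by simp
  qed
  have ev1: "\<forall>\<^sub>F d in sequentially. d \<ge> 1" by (rule eventually_ge_at_top)
  \<comment> \<open>The step size is 0 at d = 0 and may exceed 1 for small d, so the estimates hold
    only eventually.\<close>
  have ev: "\<forall>\<^sub>F d in sequentially. d \<ge> 1 \<and> 0 < \<sigma> d \<and> \<sigma> d \<le> 1"
    using ev1 order_tendstoD(2)[OF \<sigma>_lim zero_less_one] by eventually_elim (use \<sigma>_pos in auto)
  have "filterlim \<sigma> (at 0 within {0<..1}) sequentially"
    unfolding filterlim_at using \<sigma>_lim ev by (auto elim: eventually_mono)
  then have ratio: "(\<lambda>d. v d / \<sigma> d ^ 6) \<longlonglongrightarrow> \<kappa>2"
    unfolding v_def \<kappa>2_def by (rule filterlim_compose[OF incr_square])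
  have mv: "(\<lambda>d. m d * v d) \<longlonglongrightarrow> s\<^sup>2"
  proof -
    have "(\<lambda>d. m d / d * l ^ 6 * (v d / \<sigma> d ^ 6)) \<longlonglongrightarrow> s\<^sup>2"
      unfolding s2 by (intro tendsto_intros m_lim ratio)
    then show ?thesis
    proof (rule Lim_transform_eventually)
      show "\<forall>\<^sub>F d in sequentially. m d / d * l ^ 6 * (v d / \<sigma> d ^ 6) = m d * v d"
        using ev1 by eventually_elim (use l in \<open>simp add: \<sigma>6\<close>)
    qed
  qed
  have v0: "v \<longlonglongrightarrow> 0"
  proof -
    have "(\<lambda>d. \<sigma> d ^ 6 * (v d / \<sigma> d ^ 6)) \<longlonglongrightarrow> 0 ^ 6 * \<kappa>2"
      by (intro tendsto_intros \<sigma>_lim ratio)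
    then have "(\<lambda>d. \<sigma> d ^ 6 * (v d / \<sigma> d ^ 6)) \<longlonglongrightarrow> 0" by simp
    then show ?thesis
    proof (rule Lim_transform_eventually)
      show "\<forall>\<^sub>F d in sequentially. \<sigma> d ^ 6 * (v d / \<sigma> d ^ 6) = v d"
        using ev by eventually_elim auto
    qed
  qed
  obtain K where K: "\<And>\<sigma>. 0 < \<sigma> \<Longrightarrow> \<sigma> \<le> 1 \<Longrightarrow> integrable pair (\<lambda>w. \<bar>incr \<sigma> w\<bar> ^ 3) \<and>
      (\<integral>w. \<bar>incr \<sigma> w\<bar> ^ 3 \<partial>pair) \<le> K * \<sigma> ^ 9"
    using incr_cube by blast
  let ?M' = "distr std_normal_distribution borel (\<lambda>w. s * w - s\<^sup>2 / 2)"
  have sub: "{..<m d} \<subseteq> {..<d}" for d using m[of d] by auto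
  have rd: "real_distribution (law d (\<sigma> d) {..<m d})" for d
    by (rule real_distribution_law[OF sub])
  have rd': "real_distribution ?M'"
    by (intro prob_space.real_distribution_distr prob_space_noise) auto
  have "(\<lambda>d. char (law d (\<sigma> d) {..<m d}) t) \<longlonglongrightarrow> char ?M' t" for t
  proof -
    let ?u = "- (\<i> * t / 2) - t\<^sup>2 / 2 :: complex"
    let ?k = "\<bar>t\<bar> ^ 3 / 6 + \<bar>t\<bar> / 3"
    have "(\<lambda>d. (CLINT w|pair. iexp (t * incr (\<sigma> d) w)) ^ m d) \<longlonglongrightarrow> exp (of_real (s\<^sup>2) * ?u)"
    proof (rule power_tendsto_exp[where e = "\<lambda>d. ?k * (K * \<sigma> d ^ 9)"])
      show "cmod (CLINT w|pair. iexp (t * incr (\<sigma> d) w)) \<le> 1" for d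
        by (rule order_trans[OF integral_norm_bound]) (simp add: TZ.prob_space)
      show "Re ?u \<le> 0" by simp
      show "0 \<le> v d" for d unfolding v_def by simp
      show "\<forall>\<^sub>F d in sequentially. cmod ((CLINT w|pair. iexp (t * incr (\<sigma> d) w)) - (1 + v d * ?u)) \<le> ?k * (K * \<sigma> d ^ 9)"
        using ev
      proof eventually_elim
        case (elim d)
        have "cmod ((CLINT w|pair. iexp (t * incr (\<sigma> d) w)) - (1 + v d * ?u)) \<le> ?k * (\<integral>w. \<bar>incr (\<sigma> d) w\<bar> ^ 3 \<partial>pair)"
          unfolding v_def using elim K[of "\<sigma> d"] by (intro TZ.char_expansion mean_incr) auto
        also have "\<dots> \<le> ?k * (K * \<sigma> d ^ 9)"
          using elim K[of "\<sigma> d"] by (intro mult_left_mono) auto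
        finally show ?case .
      qed
      \<comment> \<open>Six of the nine powers of the step size turn m into m/d; the remaining
        \<open>\<sigma> d ^ 3\<close> drives the accumulated third-moment error to 0.\<close>
      have "(\<lambda>d. ?k * K * (m d / d) * l ^ 6 * \<sigma> d ^ 3) \<longlonglongrightarrow> ?k * K * c * l ^ 6 * 0 ^ 3"
        by (intro tendsto_intros \<sigma>_lim m_lim)
      then have "(\<lambda>d. ?k * K * (m d / d) * l ^ 6 * \<sigma> d ^ 3) \<longlonglongrightarrow> 0" by simp
      then show "(\<lambda>d. m d * (?k * (K * \<sigma> d ^ 9))) \<longlonglongrightarrow> 0"
      proof (rule Lim_transform_eventually)
        show "\<forall>\<^sub>F d in sequentially. ?k * K * (m d / d) * l ^ 6 * \<sigma> d ^ 3 = m d * (?k * (K * \<sigma> d ^ 9))"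
          using ev1
        proof eventually_elim
          case (elim d)
          have "\<sigma> d ^ 9 = \<sigma> d ^ 6 * \<sigma> d ^ 3" by (simp flip: power_add)
          then show ?case unfolding \<sigma>6[OF elim] by simp
        qed
      qed
    qed (use mv v0 in auto)
    then show ?thesis
      unfolding char_law[OF sub] char_shifted_gaussian by simp
  qed
  then have weak: "weak_conv_m (\<lambda>d. law d (\<sigma> d) {..<m d}) ?M'"
    using rd rd' by (intro levy_continuity)
  have "(\<lambda>d. \<integral>r. min 1 (exp r) \<partial>law d (\<sigma> d) {..<m d}) \<longlonglongrightarrow> (\<integral>r. min 1 (exp r) \<partial>?M')"
    using rd rd' weak by (rule weak_conv_imp_integral_bdd_continuous_conv[where B = 1])
      (auto intro!: continuous_min)
  moreover have "(\<integral>r. min 1 (exp r) \<partial>?M') = 2 * Phi (- (s / 2))"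
    by (subst integral_distr) (auto simp: expectation_min_one_exp_gaussian[OF s])
  moreover have "\<forall>\<^sub>F d in sequentially. (\<integral>r. min 1 (exp r) \<partial>law d (\<sigma> d) {..<m d}) = mala_accept g d (m d) (\<sigma> d)"
    using ev by eventually_elim (simp add: mala_accept_eq_law m)
  ultimately show ?thesis
    unfolding \<sigma>_def[symmetric] \<kappa>2_def[symmetric] s_def[symmetric]
    by (auto intro: Lim_transform_eventually)
qed

end

section \<open>The stated hypotheses brought into the form of the locale\<close>

theorem theorem4p1:
  fixes g :: "real \<Rightarrow> real" and G :: "nat \<Rightarrow> real \<Rightarrow> real"
    and cd :: "nat \<Rightarrow> real" and c l :: real
  assumes G0: "G 0 = g"
    and Gderiv: "\<And>i x. i < 8 \<Longrightarrow> (G i has_real_derivative G (Suc i) x) (at x)"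
    and G8cont: "continuous_on UNIV (G 8)"
    and growth: "\<exists>C K0. C > 0 \<and> K0 > 0 \<and> (\<forall>x. \<bar>g x\<bar> \<le> C * (1 + \<bar>x\<bar> powr K0)
                    \<and> (\<forall>i\<in>{1..8}. \<bar>G i x\<bar> \<le> C * (1 + \<bar>x\<bar> powr K0)))"
    and dens_int: "integrable lborel (\<lambda>x. exp (g x))"
    and dens_one: "integral\<^sup>L lborel (\<lambda>x. exp (g x)) = 1"
    and moments: "\<And>k::nat. k \<ge> 1 \<Longrightarrow> integrable lborel (\<lambda>x. \<bar>x\<bar> ^ k * exp (g x))"
    and lip: "\<exists>L. L-lipschitz_on UNIV (G 1)"
    and cd_range: "\<And>d. d \<ge> 1 \<Longrightarrow> 0 < cd d \<and> cd d \<le> 1"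
    and cd_int: "\<And>d. d \<ge> 1 \<Longrightarrow> real d * cd d \<in> \<int>"
    and cd_lim: "cd \<longlonglongrightarrow> c"
    and c_pos: "0 < c" and c_le: "c \<le> 1"
    and l_pos: "0 < l"
  shows "integral\<^sup>L lborel (\<lambda>x. exp (g x) * ((5 * (G 3 x)\<^sup>2 - 3 * (G 2 x) ^ 3) / 48)) > 0
    \<and> (\<lambda>d. mala_accept g d (nat \<lfloor>real d * cd d\<rfloor>) (l * real d powr (-1/6)))
        \<longlonglongrightarrow> 2 * Phi (- (sqrt c * sqrt (integral\<^sup>L lborel
              (\<lambda>x. exp (g x) * ((5 * (G 3 x)\<^sup>2 - 3 * (G 2 x) ^ 3) / 48))) * l ^ 3 / 2))"
proof -
  have target: "mala_target g (G 1) (G 2) (G 3)"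
  proof
    show "(g has_real_derivative G 1 x) (at x)" "(G 1 has_real_derivative G 2 x) (at x)"
      "(G 2 has_real_derivative G 3 x) (at x)" for x
      using Gderiv[of 0 x] Gderiv[of 1 x] Gderiv[of 2 x] G0 by (simp_all add: numeral_2_eq_2 numeral_3_eq_3)
    show "continuous_on UNIV (G 3)"
      using Gderiv[of 3] DERIV_continuous_on[of UNIV "G 3" "G (Suc 3)"] by simp
    obtain C K0 where C: "C > 0" and growth': "\<And>x i. i \<in> {1..8} \<Longrightarrow> \<bar>G i x\<bar> \<le> C * (1 + \<bar>x\<bar> powr K0)"
      and K0: "K0 > 0"
      using growth by blast
    \<comment> \<open>The real exponent is rounded up to a natural one, which is harmless on the
      base 1 + |x| \<ge> 1; the summand 1 is absorbed by doubling the constant.\<close>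
    define N where "N = nat \<lceil>K0\<rceil>"
    have "\<bar>G i x\<bar> \<le> 2 * C * (1 + \<bar>x\<bar>) ^ N" if i: "i \<in> {1..8}" for i x
    proof -
      have "\<bar>x\<bar> powr K0 \<le> (1 + \<bar>x\<bar>) powr K0"
        using K0 by (intro powr_mono2) auto
      also have "\<dots> \<le> (1 + \<bar>x\<bar>) powr real N"
        unfolding N_def using K0 by (intro powr_mono) (auto simp: le_of_int_ceiling)
      also have "\<dots> = (1 + \<bar>x\<bar>) ^ N"
        by (rule powr_realpow) (simp add: add_pos_nonneg)
      finally have "\<bar>x\<bar> powr K0 \<le> (1 + \<bar>x\<bar>) ^ N" .
      moreover have "1 \<le> (1 + \<bar>x\<bar>) ^ N"
        by (rule one_le_power) simp
      ultimately have "1 + \<bar>x\<bar> powr K0 \<le> 2 * (1 + \<bar>x\<bar>) ^ N"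
        by linarith
      then have "C * (1 + \<bar>x\<bar> powr K0) \<le> C * (2 * (1 + \<bar>x\<bar>) ^ N)"
        using C by (intro mult_left_mono) auto
      then show ?thesis using growth'[OF i, of x] by simp
    qed
    then show "\<exists>C N. \<forall>x. \<bar>G 1 x\<bar> \<le> C * (1 + \<bar>x\<bar>) ^ N \<and> \<bar>G 2 x\<bar> \<le> C * (1 + \<bar>x\<bar>) ^ N \<and>
        \<bar>G 3 x\<bar> \<le> C * (1 + \<bar>x\<bar>) ^ N"
      by (intro exI[of _ "2 * C"] exI[of _ N]) auto
    show "integrable lborel (\<lambda>x. \<bar>x\<bar> ^ k * exp (g x))" for k
      using moments[of k] dens_int by (cases "k = 0") auto
  qed (rule dens_one)
  interpret mala_target g "G 1" "G 2" "G 3" by (rule target)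
  define m where "m d = nat \<lfloor>real d * cd d\<rfloor>" for d
  \<comment> \<open>Integrality makes the floor exact for d \<ge> 1, so m/d is equal to
    \<open>cd d\<close> and no rounding error enters the limit.\<close>
  have m: "real (m d) = real d * cd d" if "d \<ge> 1" for d
  proof -
    have "0 \<le> real d * cd d" using cd_range[OF that] by simp
    then show ?thesis unfolding m_def using cd_int[OF that] by (simp add: Ints_def)
  qed
  have m_le: "m d \<le> d" for d
  proof (cases "d = 0")
    case False
    then have "real d * cd d \<le> real d * 1"
      using cd_range[of d] by (intro mult_left_mono) auto
    moreover have "1 \<le> d" using False by simp
    ultimately have "real (m d) \<le> real d" by (simp only: m mult_1_right)
    then show ?thesis by simp
  qed (simp add: m_def)
  have "(\<lambda>d. m d / d) \<longlonglongrightarrow> c"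
    using cd_lim
  proof (rule Lim_transform_eventually)
    show "\<forall>\<^sub>F d in sequentially. cd d = m d / d"
      using eventually_ge_at_top[of 1] by eventually_elim (simp add: m)
  qed
  from acceptance_rate_limit[OF l_pos c_pos m_le this] show ?thesis
    using lead_second_moment_pos unfolding lead_second_moment_kappa m_def by simp
qed

end
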